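(* Let $k:(0,T]\to\mathbb{R}$ satisfy $k\in L_1(0,T)\cap C(0,T]$, $k>0$, $k$ decreasing, and $k(t)\to\infty$ as $t\to0^+$. Assume $a_{ij},a_j\in C(\overline\Omega)$, $\omega\in (C(\partial\Omega))^n$, $f\in C(\mathbb{R}\times[0,T]\times\overline\Omega)$, and $$\exists M\ge 0,\ \eta>0:\quad f(w,t,x)\ge -M|w|\quad\text{in }(-\eta,0)\times[0,T]\times\overline\Omega .$$ Let $u\in C([0,T]\times\overline\Omega)$ with $u_{x_j},u_{x_ix_j}\in C((0,T]\times\overline\Omega)$ and $D_t^{\{k\}}(u-u_0)\in C((0,T]\times\overline\Omega)$ solve the problem $$D_t^{\{k\}}[u(t,x)-u_0(x)]=A(x)u(t,x)+f(u(t,x),t,x),\quad t\in(0,T),\ x\in\Omega,$$ $$u(0,x)=u_0(x),\ x\in\Omega,\qquad \mathcal{B}u(t,x)=g(t,x),\ (t,x)\in(0,T)\times\partial\Omega .$$ Moreover, let $$\lim_{\epsilon\to0^+}\frac1\epsilon\int_0^\epsilon k(\tau)\,d\tau\,\sup_{0\le s\le\epsilon}|u(t-s,x)-u(t,x)|=0\qquad\forall t\in(0,T],\ x\in\overline\Omega .$$ Finally, assume $u_0\ge0$ and $g\ge0$. Then: (i) $u\ge0$; (ii) if $u(t_0,x_0)=0$ at some point $(t_0,x_0)\in(0,T]\times\Omega_N$, then $u(t,x_0)=0$ for any $t\in[0,t_0]$.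
   Context: $\Omega\subset\mathbb{R}^n$ is a bounded open domain with sufficiently smooth boundary $\partial\Omega$, and $T>0$. $$A(x)=\sum_{i,j=1}^n a_{ij}(x)\frac{\partial^2}{\partial x_i\partial x_j}+\sum_{j=1}^n a_j(x)\frac{\partial}{\partial x_j}$$ is uniformly elliptic: there is $c>0$ with $\sum_{i,j}a_{ij}(x)\xi_i\xi_j\ge c|\xi|^2$ for all $\xi\in\mathbb{R}^n$, $x\in\Omega$. The boundary operator is either (case I) $\mathcal{B}u=u$ or (case II) $\mathcal{B}u=\omega\cdot\nabla u$, where $\nabla$ is the gradient in $x$ and $\omega=\omega(x)$ is a vector function on $\partial\Omega$ with $\omega(x)\cdot\nu(x)>0$, $\nu$ being the outer normal to $\partial\Omega$. The operator $D_t^{\{k\}}$ is $D_t^{\{k\}}v=\frac{d}{dt}(k*v)$, $(k*v)(t)=\int_0^t k(t-\tau)v(\tau)\,d\tau$. Set $\Omega_N=\Omega$ in case I and $\Omega_N=\overline\Omega$ in case II. *)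

theory Defs
  imports "HOL-Analysis.Analysis"
begin

definition conv :: "(real \<Rightarrow> real) \<Rightarrow> (real \<Rightarrow> real) \<Rightarrow> real \<Rightarrow> real" where
  "conv k v t = (LBINT \<tau>:{0<..<t}. k (t - \<tau>) * v \<tau>)"

text \<open>
  The derivative is one-sided at the right end point of \<open>{0..T}\<close>. The value is
  meaningful only where \<open>conv k v\<close> is differentiable, which has to be assumed separately.
\<close>

definition Dk :: "real \<Rightarrow> (real \<Rightarrow> real) \<Rightarrow> (real \<Rightarrow> real) \<Rightarrow> real \<Rightarrow> real" where
  "Dk T k v t = vector_derivative (conv k v) (at t within {0..T})"

definition has_partial_derivative ::
  "(real^'n \<Rightarrow> real) \<Rightarrow> 'n \<Rightarrow> real \<Rightarrow> real^'n \<Rightarrow> bool" where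
  "has_partial_derivative v j d x \<longleftrightarrow>
     ((\<lambda>h. v (x + h *\<^sub>R axis j 1)) has_real_derivative d) (at 0)"

text \<open>
  The function \<open>v\<close> has first and second partial derivatives in the open set \<open>\<Omega>\<close>, for
  every time in \<open>I\<close>, and these extend continuously to \<open>I \<times> closure \<Omega>\<close>. The extensions
  are \<open>Dv\<close> (gradient) and \<open>D2v\<close> (matrix of second derivatives); their values at
  boundary points are the derivatives of \<open>v\<close> there.
\<close>

definition C2_space_closure ::
  "real set \<Rightarrow> (real^'n) set \<Rightarrow> (real \<Rightarrow> real^'n \<Rightarrow> real) \<Rightarrow>
   (real \<Rightarrow> real^'n \<Rightarrow> real^'n) \<Rightarrow> (real \<Rightarrow> real^'n \<Rightarrow> real^'n^'n) \<Rightarrow> bool" where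
  "C2_space_closure I \<Omega> v Dv D2v \<longleftrightarrow>
     (\<forall>t\<in>I. \<forall>x\<in>\<Omega>. \<forall>j. has_partial_derivative (v t) j (Dv t x $ j) x) \<and>
     (\<forall>t\<in>I. \<forall>x\<in>\<Omega>. \<forall>i j. has_partial_derivative (\<lambda>y. Dv t y $ j) i (D2v t x $ i $ j) x) \<and>
     continuous_on (I \<times> closure \<Omega>) (\<lambda>(t, x). Dv t x) \<and>
     continuous_on (I \<times> closure \<Omega>) (\<lambda>(t, x). D2v t x)"

definition uniformly_elliptic :: "(real^'n) set \<Rightarrow> (real^'n \<Rightarrow> real^'n^'n) \<Rightarrow> bool" where
  "uniformly_elliptic \<Omega> a \<longleftrightarrow>
     (\<exists>c>0. \<forall>x\<in>\<Omega>. \<forall>\<xi>. (\<Sum>i\<in>UNIV. \<Sum>j\<in>UNIV. a x $ i $ j * \<xi> $ i * \<xi> $ j) \<ge> c * (norm \<xi>)\<^sup>2)"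

text \<open>
  The operator with coefficients \<open>a\<close>, \<open>b\<close> at the point \<open>x\<close>, applied to a function whose
  gradient and second derivatives at \<open>x\<close> are \<open>p\<close> and \<open>H\<close>.
\<close>

definition elliptic_op ::
  "(real^'n \<Rightarrow> real^'n^'n) \<Rightarrow> (real^'n \<Rightarrow> real^'n) \<Rightarrow> real^'n \<Rightarrow> real^'n \<Rightarrow> real^'n^'n \<Rightarrow> real" where
  "elliptic_op a b x p H =
     (\<Sum>i\<in>UNIV. \<Sum>j\<in>UNIV. a x $ i $ j * H $ i $ j) + (\<Sum>j\<in>UNIV. b x $ j * p $ j)"

text \<open>
  Near \<open>p\<close> the set \<open>\<Omega>\<close> is the region \<open>\<phi> < 0\<close> of a continuously differentiable function
  with nonvanishing gradient \<open>D\<phi>\<close>. In particular \<open>frontier \<Omega>\<close> is \<open>\<phi> = 0\<close> near \<open>p\<close>, \<open>\<Omega>\<close>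
  lies on one side of it, and \<open>D\<phi>\<close> points out of \<open>\<Omega>\<close>.
\<close>

definition local_defining_function ::
  "(real^'n) set \<Rightarrow> real^'n \<Rightarrow> (real^'n) set \<Rightarrow> (real^'n \<Rightarrow> real) \<Rightarrow> (real^'n \<Rightarrow> real^'n) \<Rightarrow> bool" where
  "local_defining_function \<Omega> p U \<phi> D\<phi> \<longleftrightarrow>
     open U \<and> p \<in> U \<and>
     (\<forall>x\<in>U. (\<phi> has_derivative (\<lambda>h. D\<phi> x \<bullet> h)) (at x)) \<and> continuous_on U D\<phi> \<and>
     (\<forall>x\<in>U. D\<phi> x \<noteq> 0) \<and> \<Omega> \<inter> U = {x \<in> U. \<phi> x < 0}"

definition C1_boundary :: "(real^'n) set \<Rightarrow> bool" where
  "C1_boundary \<Omega> \<longleftrightarrow> (\<forall>p\<in>frontier \<Omega>. \<exists>U \<phi> D\<phi>. local_defining_function \<Omega> p U \<phi> D\<phi>)"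

definition is_outer_normal :: "(real^'n) set \<Rightarrow> real^'n \<Rightarrow> real^'n \<Rightarrow> bool" where
  "is_outer_normal \<Omega> p \<nu> \<longleftrightarrow>
     (\<exists>U \<phi> D\<phi>. local_defining_function \<Omega> p U \<phi> D\<phi> \<and> \<nu> = D\<phi> p /\<^sub>R norm (D\<phi> p))"

definition outer_normal :: "(real^'n) set \<Rightarrow> real^'n \<Rightarrow> real^'n" where
  "outer_normal \<Omega> p = (THE \<nu>. is_outer_normal \<Omega> p \<nu>)"

lemma local_defining_function_zero:
  assumes "local_defining_function \<Omega> p U \<phi> D\<phi>" "p \<in> frontier \<Omega>" "open \<Omega>"
  shows "\<phi> p = 0"
proof (rule ccontr)
  assume "\<phi> p \<noteq> 0"
  have U: "open U" "p \<in> U" and eq: "\<Omega> \<inter> U = {x \<in> U. \<phi> x < 0}"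
    and d: "(\<phi> has_derivative (\<lambda>h. D\<phi> p \<bullet> h)) (at p)"
    using assms(1) by (auto simp: local_defining_function_def)
  have "p \<notin> \<Omega>" using assms(2,3) by (auto simp: frontier_def interior_open)
  then have "\<phi> p > 0" using eq U \<open>\<phi> p \<noteq> 0\<close> by force
  moreover have "isCont \<phi> p" using d has_derivative_continuous by blast
  ultimately have "\<forall>\<^sub>F x in at p. \<phi> x > 0"
    by (intro order_tendstoD) (auto simp: isCont_def)
  moreover have "\<forall>\<^sub>F x in at p. x \<in> U" using U by (rule eventually_at_in_open')
  ultimately have "\<forall>\<^sub>F x in at p. x \<notin> \<Omega>" by eventually_elim (use eq in force)
  moreover have "p islimpt \<Omega>"
    using assms(2) \<open>p \<notin> \<Omega>\<close> by (auto simp: frontier_def closure_def)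
  ultimately show False
    by (auto simp: islimpt_conv_frequently_at frequently_def)
qed

lemma local_defining_function_descent:
  assumes "local_defining_function \<Omega> p U \<phi> D\<phi>" "\<phi> p = 0" "D\<phi> p \<bullet> h < 0"
  shows "\<forall>\<^sub>F s in at_right 0. p + s *\<^sub>R h \<in> U \<and> \<phi> (p + s *\<^sub>R h) < 0"
proof -
  have U: "open U" "p \<in> U"
    and d: "(\<phi> has_derivative (\<lambda>h. D\<phi> p \<bullet> h)) (at p)"
    using assms(1) by (auto simp: local_defining_function_def)
  have "((\<lambda>s. \<phi> (p + s *\<^sub>R h)) has_derivative (\<lambda>s. D\<phi> p \<bullet> (s *\<^sub>R h))) (at 0)"
    by (rule has_derivative_compose[of "\<lambda>s. p + s *\<^sub>R h" "\<lambda>s. s *\<^sub>R h", simplified])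
       (use d in \<open>auto intro!: derivative_eq_intros\<close>)
  then have "((\<lambda>s. \<phi> (p + s *\<^sub>R h)) has_real_derivative D\<phi> p \<bullet> h) (at 0)"
    by (simp add: has_field_derivative_def mult_commute_abs)
  then obtain d where d: "d > 0" "\<And>s. 0 < s \<Longrightarrow> s < d \<Longrightarrow> \<phi> (p + s *\<^sub>R h) < 0"
    using DERIV_neg_dec_right[of "\<lambda>s. \<phi> (p + s *\<^sub>R h)" "D\<phi> p \<bullet> h" 0] assms(2,3) by auto
  have "((\<lambda>s. p + s *\<^sub>R h) \<longlongrightarrow> p + 0 *\<^sub>R h) (at_right 0)"
    by (intro tendsto_intros)
  then have "\<forall>\<^sub>F s in at_right 0. p + s *\<^sub>R h \<in> U"
    using U by (intro topological_tendstoD) auto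
  moreover have "\<forall>\<^sub>F s in at_right 0. \<phi> (p + s *\<^sub>R h) < 0"
    using d eventually_at_right_real[of 0 d] by (auto elim: eventually_mono)
  ultimately show ?thesis by eventually_elim auto
qed

lemma is_outer_normal_unique:
  assumes "is_outer_normal \<Omega> p \<nu>" "is_outer_normal \<Omega> p \<mu>" "p \<in> frontier \<Omega>" "open \<Omega>"
  shows "\<nu> = \<mu>"
proof (rule ccontr)
  assume ne: "\<nu> \<noteq> \<mu>"
  obtain U \<phi> D\<phi> where 1: "local_defining_function \<Omega> p U \<phi> D\<phi>" "\<nu> = D\<phi> p /\<^sub>R norm (D\<phi> p)"
    using assms(1) by (auto simp: is_outer_normal_def)
  obtain V \<psi> D\<psi> where 2: "local_defining_function \<Omega> p V \<psi> D\<psi>" "\<mu> = D\<psi> p /\<^sub>R norm (D\<psi> p)"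
    using assms(2) by (auto simp: is_outer_normal_def)
  have nz: "D\<phi> p \<noteq> 0" "D\<psi> p \<noteq> 0"
    using 1 2 by (auto simp: local_defining_function_def)
  have n: "norm \<nu> = 1" "norm \<mu> = 1" using 1 2 nz by auto
  define h where "h = \<mu> - \<nu>"
  have "(norm (\<mu> - \<nu>))\<^sup>2 > 0" using ne by simp
  then have lt: "\<mu> \<bullet> \<nu> < 1"
    using n by (simp add: power2_norm_eq_inner algebra_simps inner_commute norm_eq_1)
  have eqs: "D\<phi> p = norm (D\<phi> p) *\<^sub>R \<nu>" "D\<psi> p = norm (D\<psi> p) *\<^sub>R \<mu>"
    using 1 2 nz by auto
  have "\<nu> \<bullet> h < 0" "\<mu> \<bullet> (- h) < 0"
    using n lt by (auto simp: h_def algebra_simps inner_commute norm_eq_1)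
  then have a: "D\<phi> p \<bullet> h < 0" "(- D\<psi> p) \<bullet> h < 0"
    using nz by (subst eqs; simp add: mult_pos_neg)+
  have z: "\<phi> p = 0" "\<psi> p = 0"
    using local_defining_function_zero 1(1) 2(1) assms(3,4) by blast+
  have "\<forall>\<^sub>F s in at_right 0. p + s *\<^sub>R h \<in> \<Omega>"
    using local_defining_function_descent[OF 1(1) z(1) a(1)]
    by eventually_elim (use 1(1) in \<open>auto simp: local_defining_function_def\<close>)
  moreover
  have "((\<lambda>s. \<psi> (p + s *\<^sub>R h)) has_derivative (\<lambda>s. D\<psi> p \<bullet> (s *\<^sub>R h))) (at 0)"
    by (rule has_derivative_compose[of "\<lambda>s. p + s *\<^sub>R h" "\<lambda>s. s *\<^sub>R h", simplified])
       (use 2(1) in \<open>auto intro!: derivative_eq_intros simp: local_defining_function_def\<close>)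
  then have "((\<lambda>s. \<psi> (p + s *\<^sub>R h)) has_real_derivative D\<psi> p \<bullet> h) (at 0)"
    by (simp add: has_field_derivative_def mult_commute_abs)
  then obtain d where d: "d > 0" "\<And>s. 0 < s \<Longrightarrow> s < d \<Longrightarrow> \<psi> (p + s *\<^sub>R h) > 0"
    using DERIV_pos_inc_right[of "\<lambda>s. \<psi> (p + s *\<^sub>R h)" "D\<psi> p \<bullet> h" 0] a z by auto
  have "\<forall>\<^sub>F s in at_right 0. \<psi> (p + s *\<^sub>R h) > 0"
    using d eventually_at_right_real[of 0 d] by (auto elim: eventually_mono)
  moreover have "((\<lambda>s. p + s *\<^sub>R h) \<longlongrightarrow> p + 0 *\<^sub>R h) (at_right 0)"
    by (intro tendsto_intros)
  then have "\<forall>\<^sub>F s in at_right 0. p + s *\<^sub>R h \<in> V"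
    using 2(1) by (intro topological_tendstoD) (auto simp: local_defining_function_def)
  ultimately have "\<forall>\<^sub>F s in at_right (0::real). False"
  proof eventually_elim
    case (elim s)
    then have "p + s *\<^sub>R h \<in> \<Omega> \<inter> V" by blast
    also have "\<Omega> \<inter> V = {x \<in> V. \<psi> x < 0}"
      using 2(1) by (simp add: local_defining_function_def)
    finally show ?case using elim by simp
  qed
  then show False by simp
qed

lemma outer_normal_eqI:
  assumes "is_outer_normal \<Omega> p \<nu>" "p \<in> frontier \<Omega>" "open \<Omega>"
  shows "outer_normal \<Omega> p = \<nu>"
  unfolding outer_normal_def using assms is_outer_normal_unique by blast

lemma is_outer_normal_outer_normal:
  assumes "C1_boundary \<Omega>" "p \<in> frontier \<Omega>" "open \<Omega>"
  shows "is_outer_normal \<Omega> p (outer_normal \<Omega> p)"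
  using assms outer_normal_eqI unfolding C1_boundary_def is_outer_normal_def by metis

datatype 'v boundary_operator = Dirichlet | Oblique "'v \<Rightarrow> 'v"

fun admissible_boundary_operator ::
  "(real^'n) set \<Rightarrow> (real^'n) boundary_operator \<Rightarrow> bool" where
  "admissible_boundary_operator \<Omega> Dirichlet \<longleftrightarrow> True"
| "admissible_boundary_operator \<Omega> (Oblique \<omega>) \<longleftrightarrow>
     continuous_on (frontier \<Omega>) \<omega> \<and> (\<forall>x\<in>frontier \<Omega>. \<omega> x \<bullet> outer_normal \<Omega> x > 0)"

text \<open>The arguments \<open>r\<close> and \<open>p\<close> are the value and the gradient of a function at \<open>x\<close>.\<close>

fun boundary_op :: "(real^'n) boundary_operator \<Rightarrow> real^'n \<Rightarrow> real \<Rightarrow> real^'n \<Rightarrow> real" where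
  "boundary_op Dirichlet x r p = r"
| "boundary_op (Oblique \<omega>) x r p = \<omega> x \<bullet> p"

fun Omega_N :: "(real^'n) boundary_operator \<Rightarrow> (real^'n) set \<Rightarrow> (real^'n) set" where
  "Omega_N Dirichlet \<Omega> = \<Omega>"
| "Omega_N (Oblique \<omega>) \<Omega> = closure \<Omega>"

end

theory Submission
  imports Defs
begin

text \<open>
  The operator \<open>Dk\<close> obeys a one-sided minimum rule in time. Formally, integration by parts gives
  \<open>Dk v t = k t * v t + (integral over 0 < \<tau> < t of (v t - v (t - \<tau>)) d(- k)(\<tau>))\<close>,
  where \<open>- k\<close> is increasing. If \<open>v t \<le> 0\<close> is the minimum of \<open>v\<close> over \<open>{0..t}\<close>, both terms are nonpositive,
  and every window \<open>{p..q}\<close> of time lags in which \<open>v\<close> exceeds \<open>v t\<close> by \<open>m\<close> lowers the value by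
  \<open>m * (k p - k q)\<close>. Lemma \<open>Dk_le_at_min\<close> proves this with difference quotients from the left;
  the assumed decay of the oscillation of \<open>u\<close> removes the contribution of the singularity of \<open>k\<close> at 0.
  
  In space, the equation extends by continuity to \<open>closure \<Omega>\<close> and to the final time, so it can be used at
  boundary minima without a boundary point lemma. At a minimum on the boundary the one-sided first order
  conditions, together with the sign of the oblique derivative, force the whole gradient to vanish; the
  second order conditions along inward directions then make the Hessian positive semidefinite. Hence the
  elliptic operator is nonnegative at interior minima and at oblique boundary minima
  (\<open>elliptic_op_nonneg_at_min\<close>), and there \<open>Dk (u - u0) \<ge> f\<close>.
  
  For (i), advance in time by a fixed step \<open>\<delta>\<close> so small that \<open>M < k\<close> on lags up to \<open>\<delta>\<close>, and that \<open>u\<close> cannot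
  fall below \<open>- \<eta>\<close> within one step. If \<open>u \<ge> 0\<close> up to time \<open>s\<close> and \<open>u\<close> has a negative minimum over the next slab
  at time \<open>t\<close>, then all lags in \<open>{t - s..t}\<close> reach back to nonnegative values, so
  \<open>Dk (u - u0) \<le> k (t - s) * u < M * u \<le> f\<close>, a contradiction.
  
  For (ii), a zero of \<open>u \<ge> 0\<close> is a minimum, and \<open>f\<close> is nonnegative at the value 0, so \<open>Dk (u - u0) \<ge> 0\<close>. If \<open>u\<close> were
  positive at an earlier time, take the first zero \<open>t1\<close> after it. The minimum rule leaves no room for
  \<open>k p > k q\<close> on the lags at which \<open>u\<close> is positive just before \<open>t1\<close>; so \<open>k\<close> would be constant near 0,
  against \<open>k \<rightarrow> \<infinity>\<close>.
  
  The initial condition is imposed inside \<open>\<Omega>\<close>, whereas both arguments also use it at boundary points. There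
  it follows from the continuity of \<open>Dk (u - u0)\<close> up to the boundary (\<open>initial_value_extends\<close>).
\<close>

section \<open>Positive semidefinite matrices\<close>

text \<open>
  Gaussian elimination on the index set. Splitting off a pivot \<open>s\<close> with \<open>A s s > 0\<close> writes \<open>A\<close> as a rank one matrix
  \<open>w w\<^sup>T / A s s\<close>, where \<open>w\<close> is column \<open>s\<close>, plus a positive semidefinite Schur complement supported on
  the remaining indices. The rank one part contributes the value of the form \<open>H\<close> at \<open>w\<close>, divided by
  \<open>A s s\<close>. A zero pivot forces its whole row and column to vanish.
\<close>

lemma psd_trace_nonneg_symmetric:
  fixes A H :: "'i \<Rightarrow> 'i \<Rightarrow> real"
  assumes "finite S"
    and "\<And>i j. i \<in> S \<Longrightarrow> j \<in> S \<Longrightarrow> A i j = A j i"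
    and "\<And>x. 0 \<le> (\<Sum>i\<in>S. \<Sum>j\<in>S. A i j * x i * x j)"
    and "\<And>x. 0 \<le> (\<Sum>i\<in>S. \<Sum>j\<in>S. H i j * x i * x j)"
  shows "0 \<le> (\<Sum>i\<in>S. \<Sum>j\<in>S. A i j * H i j)"
  using assms
proof (induction S arbitrary: A rule: finite_induct)
  case empty
  then show ?case by simp
next
  case (insert s S A)
  have sym: "A i j = A j i" if "i \<in> insert s S" "j \<in> insert s S" for i j
    using insert.prems(1) that .
  have split: "(\<Sum>i\<in>insert s S. \<Sum>j\<in>insert s S. F i j) =
      (\<Sum>i\<in>S. \<Sum>j\<in>S. F i j) + (\<Sum>j\<in>S. F s j) + (\<Sum>i\<in>S. F i s) + F s s"
    for F :: "'i \<Rightarrow> 'i \<Rightarrow> real"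
    using insert.hyps by (simp add: sum.distrib algebra_simps)
  have form: "(\<Sum>i\<in>insert s S. \<Sum>j\<in>insert s S. A i j * x i * x j) =
      (\<Sum>i\<in>S. \<Sum>j\<in>S. A i j * x i * x j) + 2 * x s * (\<Sum>j\<in>S. A s j * x j) + A s s * (x s)\<^sup>2" for x
  proof -
    have "(\<Sum>i\<in>S. A i s * x i * x s) = (\<Sum>j\<in>S. A s j * x s * x j)"
      by (intro sum.cong refl) (use sym in auto)
    then show ?thesis
      unfolding split by (simp add: sum_distrib_left power2_eq_square algebra_simps)
  qed
  have HS: "0 \<le> (\<Sum>i\<in>S. \<Sum>j\<in>S. H i j * x i * x j)" for x
  proof -
    have "(\<Sum>i\<in>S. \<Sum>j\<in>S. H i j * x i * x j) =
        (\<Sum>i\<in>S. \<Sum>j\<in>S. H i j * (x(s := 0)) i * (x(s := 0)) j)"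
      using insert.hyps by (intro sum.cong refl) auto
    also have "\<dots> = (\<Sum>i\<in>insert s S. \<Sum>j\<in>insert s S. H i j * (x(s := 0)) i * (x(s := 0)) j)"
      unfolding split by simp
    finally show ?thesis using insert.prems(3)[of "x(s := 0)"] by simp
  qed
  have Ass: "0 \<le> A s s"
  proof -
    define e where "e i = (if i = s then 1 else 0 :: real)" for i
    have e: "e s = 1" "\<And>i. i \<in> S \<Longrightarrow> e i = 0" using insert.hyps by (auto simp: e_def)
    have "(\<Sum>i\<in>S. \<Sum>j\<in>S. A i j * e i * e j) = 0" "(\<Sum>j\<in>S. A s j * e j) = 0"
      by (simp_all add: e)
    then show ?thesis
      using insert.prems(2)[of e] form[of e] e(1) by simp
  qed
  have diffs: "(\<Sum>i\<in>S. \<Sum>j\<in>S. A i j * x i * x j) = (\<Sum>i\<in>S. \<Sum>j\<in>S. A i j * (x(s := c)) i * (x(s := c)) j)"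
    "(\<Sum>j\<in>S. A s j * x j) = (\<Sum>j\<in>S. A s j * (x(s := c)) j)" for x c
    using insert.hyps by (auto intro!: sum.cong)
  show ?case
  proof (cases "A s s = 0")
    case True
    have row: "A s j = 0" if "j \<in> S" for j
    proof (rule ccontr)
      assume nz: "A s j \<noteq> 0"
      \<comment> \<open>With \<open>A s s = 0\<close> the form is affine in \<open>x s\<close>; this choice makes it equal to \<open>- 1\<close>.\<close>
      define x where "x = (\<lambda>i. if i = s then - (A j j + 1) / (2 * A s j) else if i = j then 1 else 0)"
      have js: "j \<noteq> s" using that insert.hyps by auto
      have "(\<Sum>i\<in>S. \<Sum>k\<in>S. A i k * x i * x k) = (\<Sum>i\<in>S. \<Sum>k\<in>S. if i = j then (if k = j then A j j else 0) else 0)"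
        using insert.hyps by (intro sum.cong refl) (auto simp: x_def)
      also have "\<dots> = (\<Sum>i\<in>S. if i = j then A j j else 0)"
        using that insert.hyps by (intro sum.cong refl) (auto simp: sum.delta)
      also have "\<dots> = A j j"
        using that insert.hyps by (simp add: sum.delta)
      finally have 1: "(\<Sum>i\<in>S. \<Sum>k\<in>S. A i k * x i * x k) = A j j" .
      have "(\<Sum>k\<in>S. A s k * x k) = (\<Sum>k\<in>S. if k = j then A s j else 0)"
        using insert.hyps by (intro sum.cong refl) (auto simp: x_def)
      then have 2: "(\<Sum>k\<in>S. A s k * x k) = A s j"
        using that insert.hyps by (simp add: sum.delta)
      have "0 \<le> A j j + 2 * x s * A s j"
        using insert.prems(2)[of x] unfolding form 1 2 True by simp
      moreover have "2 * x s * A s j = - (A j j + 1)"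
        using nz by (simp add: x_def)
      ultimately show False by simp
    qed
    then have col: "A j s = 0" if "j \<in> S" for j
      using sym[of j s] that by simp
    have "0 \<le> (\<Sum>i\<in>S. \<Sum>j\<in>S. A i j * H i j)"
    proof (rule insert.IH)
      show "0 \<le> (\<Sum>i\<in>S. \<Sum>j\<in>S. A i j * x i * x j)" for x
        using insert.prems(2)[of "x(s := 0)"] unfolding form using diffs(1)[of x 0] by simp
    qed (use sym HS in auto)
    then show ?thesis
      unfolding split using row col True by simp
  next
    case False
    then have pos: "A s s > 0" using Ass by simp
    define A' where "A' i j = A i j - A i s * A s j / A s s" for i j
    have A'form: "(\<Sum>i\<in>S. \<Sum>j\<in>S. A' i j * x i * x j) =
        (\<Sum>i\<in>S. \<Sum>j\<in>S. A i j * x i * x j) - (\<Sum>j\<in>S. A s j * x j)\<^sup>2 / A s s" for x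
    proof -
      have "(\<Sum>j\<in>S. A s j * x j)\<^sup>2 = (\<Sum>i\<in>S. \<Sum>j\<in>S. A i s * x i * (A s j * x j))"
        unfolding power2_eq_square sum_product by (intro sum.cong refl) (use sym in auto)
      then have "(\<Sum>j\<in>S. A s j * x j)\<^sup>2 / A s s = (\<Sum>i\<in>S. \<Sum>j\<in>S. A i s * A s j / A s s * x i * x j)"
        by (simp add: sum_divide_distrib algebra_simps)
      then show ?thesis
        by (simp add: A'_def left_diff_distrib sum_subtractf)
    qed
    have 1: "0 \<le> (\<Sum>i\<in>S. \<Sum>j\<in>S. A' i j * H i j)"
    proof (rule insert.IH)
      show "A' i j = A' j i" if "i \<in> S" "j \<in> S" for i j
        using sym[of i j] sym[of i s] sym[of j s] that by (simp add: A'_def)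
      show "0 \<le> (\<Sum>i\<in>S. \<Sum>j\<in>S. A' i j * x i * x j)" for x
      proof -
        \<comment> \<open>The form of the Schur complement is the minimum of the form of \<open>A\<close> over the coordinate \<open>s\<close>.\<close>
        define L where "L = (\<Sum>j\<in>S. A s j * x j)"
        have "0 \<le> (\<Sum>i\<in>S. \<Sum>j\<in>S. A i j * x i * x j) + 2 * (- L / A s s) * L + A s s * (- L / A s s)\<^sup>2"
          using insert.prems(2)[of "x(s := - L / A s s)"]
          unfolding form diffs(1)[symmetric] diffs(2)[symmetric] L_def[symmetric] by simp
        also have "\<dots> = (\<Sum>i\<in>S. \<Sum>j\<in>S. A i j * x i * x j) - L\<^sup>2 / A s s"
          using pos by (simp add: field_simps power2_eq_square)
        finally show ?thesis unfolding A'form L_def .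
      qed
    qed (use HS in auto)
    have "(\<Sum>i\<in>insert s S. \<Sum>j\<in>insert s S. H i j * A i s * A j s) =
        (\<Sum>i\<in>insert s S. \<Sum>j\<in>insert s S. H i j * (A i s * A s j))"
      by (intro sum.cong refl) (use sym[of _ s] in auto)
    then have 2: "0 \<le> (\<Sum>i\<in>insert s S. \<Sum>j\<in>insert s S. H i j * (A i s * A s j))"
      using insert.prems(3)[of "\<lambda>i. A i s"] by simp
    have "(\<Sum>i\<in>insert s S. \<Sum>j\<in>insert s S. A i j * H i j) =
        (\<Sum>i\<in>insert s S. \<Sum>j\<in>insert s S. A' i j * H i j) +
        (\<Sum>i\<in>insert s S. \<Sum>j\<in>insert s S. H i j * (A i s * A s j)) / A s s"
      unfolding sum_divide_distrib sum.distrib[symmetric] using pos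
      by (intro sum.cong refl) (simp add: A'_def field_simps)
    also have "(\<Sum>i\<in>insert s S. \<Sum>j\<in>insert s S. A' i j * H i j) = (\<Sum>i\<in>S. \<Sum>j\<in>S. A' i j * H i j)"
      unfolding split using pos by (simp add: A'_def)
    finally show ?thesis using 1 2 pos by simp
  qed
qed

text \<open>
  Symmetry of \<open>H\<close> makes the antisymmetric part of \<open>A\<close> invisible to the double sum, so \<open>A\<close> may be
  replaced by its symmetric part.
\<close>

lemma psd_trace_nonneg:
  fixes A H :: "real^'n^'n"
  assumes A: "\<And>\<xi> :: real^'n. 0 \<le> (\<Sum>i\<in>UNIV. \<Sum>j\<in>UNIV. A $ i $ j * \<xi> $ i * \<xi> $ j)"
    and H: "\<And>\<xi> :: real^'n. 0 \<le> (\<Sum>i\<in>UNIV. \<Sum>j\<in>UNIV. H $ i $ j * \<xi> $ i * \<xi> $ j)"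
    and sym: "\<And>i j. H $ i $ j = H $ j $ i"
  shows "0 \<le> (\<Sum>i\<in>UNIV. \<Sum>j\<in>UNIV. A $ i $ j * H $ i $ j)"
proof -
  have swap: "(\<Sum>i\<in>UNIV. \<Sum>j\<in>UNIV. A $ j $ i * G i j) = (\<Sum>i\<in>UNIV. \<Sum>j\<in>UNIV. A $ i $ j * G j i)" for G :: "'n \<Rightarrow> 'n \<Rightarrow> real"
    by (rule sum.swap)
  have half: "(\<Sum>i\<in>UNIV. \<Sum>j\<in>UNIV. (A $ i $ j + A $ j $ i) / 2 * G i j) =
      (\<Sum>i\<in>UNIV. \<Sum>j\<in>UNIV. A $ i $ j * G i j)" if "\<And>i j. G i j = G j i" for G :: "'n \<Rightarrow> 'n \<Rightarrow> real"
  proof -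
    have "(\<Sum>i\<in>UNIV. \<Sum>j\<in>UNIV. (A $ i $ j + A $ j $ i) / 2 * G i j) =
       ((\<Sum>i\<in>UNIV. \<Sum>j\<in>UNIV. A $ i $ j * G i j) + (\<Sum>i\<in>UNIV. \<Sum>j\<in>UNIV. A $ j $ i * G i j)) / 2"
      by (simp add: sum.distrib[symmetric] sum_divide_distrib algebra_simps add_divide_distrib)
    then show ?thesis unfolding swap using that by (simp add: that[symmetric])
  qed
  have "0 \<le> (\<Sum>i\<in>UNIV. \<Sum>j\<in>UNIV. (A $ i $ j + A $ j $ i) / 2 * H $ i $ j)"
  proof (rule psd_trace_nonneg_symmetric)
    fix x :: "'n \<Rightarrow> real"
    show "0 \<le> (\<Sum>i\<in>UNIV. \<Sum>j\<in>UNIV. H $ i $ j * x i * x j)"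
      using H[of "\<chi> i. x i"] by simp
    have "0 \<le> (\<Sum>i\<in>UNIV. \<Sum>j\<in>UNIV. A $ i $ j * (x i * x j))"
      using A[of "\<chi> i. x i"] by (simp add: mult.assoc)
    then show "0 \<le> (\<Sum>i\<in>UNIV. \<Sum>j\<in>UNIV. (A $ i $ j + A $ j $ i) / 2 * x i * x j)"
      using half[of "\<lambda>i j. x i * x j", OF mult.commute] by (simp add: mult.assoc)
  qed (auto simp: add.commute)
  then show ?thesis using half[of "\<lambda>i j. H $ i $ j"] sym by simp
qed

section \<open>Continuous partial derivatives\<close>

lemma has_partial_derivative_line:
  assumes "has_partial_derivative v j d (z + t *\<^sub>R axis j 1)"
  shows "((\<lambda>s. v (z + s *\<^sub>R axis j 1)) has_real_derivative d) (at t)"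
proof -
  have "((\<lambda>s. v (z + t *\<^sub>R axis j 1 + s *\<^sub>R axis j 1)) has_real_derivative d) (at 0)"
    using assms by (simp add: has_partial_derivative_def)
  then have "((\<lambda>s. v (z + (s + t) *\<^sub>R axis j 1)) has_real_derivative d) (at 0)"
    by (simp add: algebra_simps)
  then show ?thesis
    using DERIV_shift[of "\<lambda>s. v (z + s *\<^sub>R axis j 1)" d 0 t] by simp
qed

text \<open>
  Change the coordinates of the argument one at a time: the mean value estimate along each coordinate
  direction costs at most \<open>e'\<close> times the norm of the increment. The induction is over the set of
  coordinates in which the increment may be nonzero.
\<close>

lemma has_derivative_continuous_partials:
  fixes v :: "real^'n \<Rightarrow> real"
  assumes \<Omega>: "open \<Omega>" and pd: "\<And>x j. x \<in> \<Omega> \<Longrightarrow> has_partial_derivative v j (Dv x $ j) x"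
    and cont: "continuous_on \<Omega> Dv" and x: "x \<in> \<Omega>"
  shows "(v has_derivative (\<lambda>h. Dv x \<bullet> h)) (at x)"
  unfolding has_derivative_at_alt
proof (intro conjI allI impI)
  show "bounded_linear (\<lambda>h. Dv x \<bullet> h)" by (rule bounded_linear_inner_right)
  fix e :: real assume "e > 0"
  define e' where "e' = e / real CARD('n)"
  have e': "e' > 0" using \<open>e > 0\<close> by (simp add: e'_def)
  have "isCont Dv x" using cont \<Omega> x by (simp add: continuous_on_eq_continuous_at)
  then obtain d1 where d1: "d1 > 0" "\<And>y. dist y x < d1 \<Longrightarrow> dist (Dv y) (Dv x) < e'"
    using e' by (auto simp: continuous_at_eps_delta)
  obtain d2 where d2: "d2 > 0" "ball x d2 \<subseteq> \<Omega>" using \<Omega> x by (auto simp: open_contains_ball)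
  define d where "d = min d1 d2"
  have claim: "\<bar>v (x + h) - v x - Dv x \<bullet> h\<bar> \<le> e' * real (card S) * norm h"
    if "finite S" "\<And>i. i \<notin> S \<Longrightarrow> h $ i = 0" "norm h < d" for S :: "'n set" and h
    using that
  proof (induction S arbitrary: h rule: finite_induct)
    case empty
    then have "h = 0" by (simp add: vec_eq_iff)
    then show ?case by simp
  next
    case (insert i S h)
    define h' where "h' = h - (h $ i) *\<^sub>R axis i 1"
    have comp: "(h' + t *\<^sub>R axis i 1) $ l = (if l = i then t else h $ l)" for t l
      by (auto simp: h'_def axis_def)
    have le: "norm (h' + t *\<^sub>R axis i 1) \<le> norm h" if "\<bar>t\<bar> \<le> \<bar>h $ i\<bar>" for t
      by (rule norm_le_componentwise_cart) (use that comp[of t] in auto)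
    have h'le: "norm h' \<le> norm h" using le[of 0] by simp
    have IH: "\<bar>v (x + h') - v x - Dv x \<bullet> h'\<bar> \<le> e' * real (card S) * norm h'"
    proof (rule insert.IH)
      show "h' $ l = 0" if "l \<notin> S" for l
        using comp[of 0 l] insert.prems(1)[of l] that by auto
    qed (use h'le insert.prems(2) in simp)
    define \<psi> where "\<psi> t = v (x + h' + t *\<^sub>R axis i 1) - t * (Dv x $ i)" for t
    have "norm (\<psi> (h $ i) - \<psi> 0) \<le> e' * norm (h $ i - 0)"
    proof (rule field_differentiable_bound[where S = "closed_segment 0 (h $ i)"
          and f' = "\<lambda>t. Dv (x + h' + t *\<^sub>R axis i 1) $ i - Dv x $ i"])
      fix t assume "t \<in> closed_segment 0 (h $ i)"
      then have t: "\<bar>t\<bar> \<le> \<bar>h $ i\<bar>"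
        by (auto simp: closed_segment_eq_real_ivl split: if_splits)
      have "dist (x + h' + t *\<^sub>R axis i 1) x < d"
        using le[OF t] insert.prems(2) by (simp add: dist_norm add.assoc)
      then have near: "dist (x + h' + t *\<^sub>R axis i 1) x < d1" "x + h' + t *\<^sub>R axis i 1 \<in> \<Omega>"
        using d2(2) by (auto simp: d_def dist_commute)
      show "norm (Dv (x + h' + t *\<^sub>R axis i 1) $ i - Dv x $ i) \<le> e'"
        using component_le_norm_cart[of "Dv (x + h' + t *\<^sub>R axis i 1) - Dv x" i] d1(2)[OF near(1)]
        by (simp add: dist_norm)
      show "(\<psi> has_field_derivative Dv (x + h' + t *\<^sub>R axis i 1) $ i - Dv x $ i)
          (at t within closed_segment 0 (h $ i))"
        unfolding \<psi>_def
        by (auto intro!: derivative_eq_intros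
            has_field_derivative_at_within[OF has_partial_derivative_line[OF pd[OF near(2)]]])
    qed auto
    moreover have "x + h' + (h $ i) *\<^sub>R axis i 1 = x + h" by (simp add: h'_def)
    then have "\<psi> (h $ i) - \<psi> 0 = v (x + h) - v (x + h') - (h $ i) * (Dv x $ i)"
      unfolding \<psi>_def by (simp only:) simp
    ultimately have 2: "\<bar>v (x + h) - v (x + h') - (h $ i) * (Dv x $ i)\<bar> \<le> e' * \<bar>h $ i\<bar>"
      by simp
    have "Dv x \<bullet> h = Dv x \<bullet> h' + (h $ i) * (Dv x $ i)"
      by (simp add: h'_def inner_diff_right inner_axis)
    then have "\<bar>v (x + h) - v x - Dv x \<bullet> h\<bar> \<le> e' * real (card S) * norm h' + e' * \<bar>h $ i\<bar>"
      using IH 2 by linarith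
    also have "\<dots> \<le> e' * real (card S) * norm h + e' * norm h"
      using h'le component_le_norm_cart[of h i] e' by (intro add_mono mult_left_mono) auto
    finally show ?case using insert.hyps by (simp add: algebra_simps)
  qed
  show "\<exists>d>0. \<forall>y. norm (y - x) < d \<longrightarrow> norm (v y - v x - Dv x \<bullet> (y - x)) \<le> e * norm (y - x)"
  proof (intro exI[of _ d] conjI allI impI)
    show "d > 0" using d1 d2 by (simp add: d_def)
    fix y assume "norm (y - x) < d"
    then show "norm (v y - v x - Dv x \<bullet> (y - x)) \<le> e * norm (y - x)"
      using claim[of UNIV "y - x"] by (simp add: e'_def)
  qed
qed

text \<open>
  The symmetric second difference of \<open>v\<close> over a small square equals, by two applications of the mean
  value theorem, the squared side times a mixed partial derivative at a nearby point; the order of the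
  two applications decides which mixed partial derivative appears.
\<close>

lemma mixed_partials_commute:
  fixes v :: "real^'n \<Rightarrow> real" and Dv :: "real^'n \<Rightarrow> real^'n" and D2v :: "real^'n \<Rightarrow> real^'n^'n"
  assumes \<Omega>: "open \<Omega>" and pd: "\<And>x j. x \<in> \<Omega> \<Longrightarrow> has_partial_derivative v j (Dv x $ j) x"
    and pd2: "\<And>x i j. x \<in> \<Omega> \<Longrightarrow> has_partial_derivative (\<lambda>y. Dv y $ j) i (D2v x $ i $ j) x"
    and cont: "continuous_on \<Omega> D2v" and x: "x \<in> \<Omega>"
  shows "D2v x $ i $ j = D2v x $ j $ i"
proof -
  obtain d2 where d2: "d2 > 0" "ball x d2 \<subseteq> \<Omega>" using \<Omega> x by (auto simp: open_contains_ball)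
  have difference: "\<exists>y. dist y x \<le> 2 * s \<and>
      v (x + s *\<^sub>R axis i 1 + s *\<^sub>R axis j 1) - v (x + s *\<^sub>R axis i 1) - v (x + s *\<^sub>R axis j 1) + v x
      = s\<^sup>2 * D2v y $ j $ i" if s: "0 < s" "2 * s < d2" for i j s
  proof -
    have in\<Omega>: "x + t *\<^sub>R axis i 1 + r *\<^sub>R axis j 1 \<in> \<Omega>" "dist (x + t *\<^sub>R axis i 1 + r *\<^sub>R axis j 1) x \<le> 2 * s"
      if "0 \<le> t" "t \<le> s" "0 \<le> r" "r \<le> s" for t r
    proof -
      have "norm (t *\<^sub>R axis i 1 + r *\<^sub>R axis j 1 :: real^'n) \<le> t + r"
        by (rule order_trans[OF norm_triangle_ineq]) (use that in \<open>simp add: norm_axis_1\<close>)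
      then show *: "dist (x + t *\<^sub>R axis i 1 + r *\<^sub>R axis j 1) x \<le> 2 * s"
        using that by (simp add: dist_norm add.assoc)
      then show "x + t *\<^sub>R axis i 1 + r *\<^sub>R axis j 1 \<in> \<Omega>"
        using d2(2) s(2) by (auto simp: subset_iff dist_commute)
    qed
    define \<phi> where "\<phi> t = v (x + s *\<^sub>R axis j 1 + t *\<^sub>R axis i 1) - v (x + t *\<^sub>R axis i 1)" for t
    have "\<exists>t>0. t < s \<and> \<phi> s - \<phi> 0 =
        (s - 0) * (Dv (x + s *\<^sub>R axis j 1 + t *\<^sub>R axis i 1) $ i - Dv (x + t *\<^sub>R axis i 1) $ i)"
    proof (rule MVT2[OF s(1)])
      fix t assume t: "0 \<le> t" "t \<le> s"
      have "x + s *\<^sub>R axis j 1 + t *\<^sub>R axis i 1 \<in> \<Omega>" "x + t *\<^sub>R axis i 1 \<in> \<Omega>"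
        using in\<Omega>[of t s] in\<Omega>[of t 0] t by (auto simp: algebra_simps)
      then show "(\<phi> has_real_derivative Dv (x + s *\<^sub>R axis j 1 + t *\<^sub>R axis i 1) $ i - Dv (x + t *\<^sub>R axis i 1) $ i) (at t)"
        unfolding \<phi>_def by (intro DERIV_diff has_partial_derivative_line pd)
    qed
    then obtain t where t: "0 < t" "t < s" and \<phi>: "\<phi> s - \<phi> 0 =
        s * (Dv (x + s *\<^sub>R axis j 1 + t *\<^sub>R axis i 1) $ i - Dv (x + t *\<^sub>R axis i 1) $ i)"
      by auto
    have "\<exists>r>0. r < s \<and> Dv (x + t *\<^sub>R axis i 1 + s *\<^sub>R axis j 1) $ i - Dv (x + t *\<^sub>R axis i 1 + 0 *\<^sub>R axis j 1) $ i =
        (s - 0) * (D2v (x + t *\<^sub>R axis i 1 + r *\<^sub>R axis j 1) $ j $ i)"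
    proof (rule MVT2[OF s(1)])
      fix r assume r: "0 \<le> r" "r \<le> s"
      show "((\<lambda>r. Dv (x + t *\<^sub>R axis i 1 + r *\<^sub>R axis j 1) $ i) has_real_derivative
          D2v (x + t *\<^sub>R axis i 1 + r *\<^sub>R axis j 1) $ j $ i) (at r)"
        by (rule has_partial_derivative_line[where v = "\<lambda>y. Dv y $ i"]) (use pd2 in\<Omega>[of t r] t r in auto)
    qed
    then obtain r where r: "0 < r" "r < s" and "Dv (x + t *\<^sub>R axis i 1 + s *\<^sub>R axis j 1) $ i - Dv (x + t *\<^sub>R axis i 1) $ i =
        s * (D2v (x + t *\<^sub>R axis i 1 + r *\<^sub>R axis j 1) $ j $ i)"
      by auto
    then have "\<phi> s - \<phi> 0 = s\<^sup>2 * D2v (x + t *\<^sub>R axis i 1 + r *\<^sub>R axis j 1) $ j $ i"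
      unfolding \<phi> by (simp add: power2_eq_square add_ac)
    moreover have "\<phi> s - \<phi> 0 = v (x + s *\<^sub>R axis i 1 + s *\<^sub>R axis j 1) - v (x + s *\<^sub>R axis i 1) - v (x + s *\<^sub>R axis j 1) + v x"
      by (simp add: \<phi>_def add.assoc add.commute[of "s *\<^sub>R axis i 1"])
    ultimately show ?thesis
      using in\<Omega>(2)[of t r] t r by (intro exI[of _ "x + t *\<^sub>R axis i 1 + r *\<^sub>R axis j 1"]) simp
  qed
  have "\<bar>D2v x $ i $ j - D2v x $ j $ i\<bar> \<le> e" if "e > 0" for e
  proof -
    have "isCont D2v x" using cont \<Omega> x by (simp add: continuous_on_eq_continuous_at)
    then obtain d1 where d1: "d1 > 0" "\<And>y. dist y x < d1 \<Longrightarrow> dist (D2v y) (D2v x) < e / 2"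
      unfolding continuous_at_eps_delta using \<open>e > 0\<close> half_gt_zero by blast
    have close: "\<bar>D2v y $ l $ m - D2v x $ l $ m\<bar> \<le> e / 2" if "dist y x < d1" for y l m
    proof -
      have "\<bar>(D2v y - D2v x) $ l $ m\<bar> \<le> norm ((D2v y - D2v x) $ l)"
        by (rule component_le_norm_cart)
      also have "\<dots> \<le> norm (D2v y - D2v x)" by (rule Finite_Cartesian_Product.norm_nth_le)
      finally show ?thesis using d1(2)[OF that] by (simp add: dist_norm)
    qed
    define s where "s = min d1 d2 / 3"
    have s: "0 < s" "2 * s < d1" "2 * s < d2" using d1(1) d2(1) by (auto simp: s_def)
    obtain y where y: "dist y x \<le> 2 * s"
      "v (x + s *\<^sub>R axis i 1 + s *\<^sub>R axis j 1) - v (x + s *\<^sub>R axis i 1) - v (x + s *\<^sub>R axis j 1) + v x = s\<^sup>2 * D2v y $ j $ i"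
      using difference[OF s(1,3), of i j] by blast
    obtain z where z: "dist z x \<le> 2 * s"
      "v (x + s *\<^sub>R axis j 1 + s *\<^sub>R axis i 1) - v (x + s *\<^sub>R axis j 1) - v (x + s *\<^sub>R axis i 1) + v x = s\<^sup>2 * D2v z $ i $ j"
      using difference[OF s(1,3), of j i] by blast
    have swap: "x + s *\<^sub>R axis j 1 + s *\<^sub>R axis i 1 = x + s *\<^sub>R axis i 1 + s *\<^sub>R axis j 1" by simp
    have "s\<^sup>2 * D2v y $ j $ i = s\<^sup>2 * D2v z $ i $ j"
      using y(2) z(2)[unfolded swap] by linarith
    then have "D2v y $ j $ i = D2v z $ i $ j" using s by simp
    moreover have "\<bar>D2v y $ j $ i - D2v x $ j $ i\<bar> \<le> e / 2" "\<bar>D2v z $ i $ j - D2v x $ i $ j\<bar> \<le> e / 2"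
      using close y(1) z(1) s by auto
    ultimately show ?thesis by linarith
  qed
  then have "\<bar>D2v x $ i $ j - D2v x $ j $ i\<bar> \<le> 0" by (rule field_le_epsilon) simp
  then show ?thesis by simp
qed

section \<open>Minima in space\<close>

text \<open>
  The tool that carries the equation, the boundary inequality, ellipticity and the sign of the initial
  value from the open sets on which they are assumed to limit points.
\<close>

lemma continuous_on_closed_property:
  fixes F :: "'a::first_countable_topology \<Rightarrow> 'b::first_countable_topology"
  assumes "continuous_on S F" "A \<subseteq> S" "S \<subseteq> closure A" "closed C"
    and "\<And>a. a \<in> A \<Longrightarrow> F a \<in> C" and x: "x \<in> S"
  shows "F x \<in> C"
proof -
  obtain X where X: "\<And>n::nat. X n \<in> A" "X \<longlonglongrightarrow> x"
    using assms(3) x closure_sequential by blast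
  have "(\<lambda>n. F (X n)) \<longlonglongrightarrow> F x"
    by (rule continuous_on_tendsto_compose[OF assms(1) X(2) x])
       (intro always_eventually allI subsetD[OF assms(2) X(1)])
  then show ?thesis
    by (rule closed_sequentially[OF assms(4), rotated]) (use assms(5) X(1) in auto)
qed

lemma right_limit_nonneg:
  fixes g :: "real \<Rightarrow> real"
  assumes "d > 0" "continuous_on {0..<d} g"
    and "\<And>s. 0 < s \<Longrightarrow> s < d \<Longrightarrow> \<exists>r\<in>{0<..<s}. 0 \<le> g r"
  shows "0 \<le> g 0"
proof (rule ccontr)
  assume "\<not> 0 \<le> g 0"
  then have neg: "- g 0 > 0" by simp
  have "0 \<in> {0..<d}" using assms(1) by simp
  then obtain e where e: "e > 0" "\<And>r. r \<in> {0..<d} \<Longrightarrow> dist r 0 < e \<Longrightarrow> dist (g r) (g 0) < - g 0"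
    using assms(2) neg unfolding continuous_on_iff by blast
  obtain r where r: "r \<in> {0<..<min (d/2) e}" "0 \<le> g r"
    using assms(3)[of "min (d/2) e"] assms(1) e(1) by force
  then have "dist (g r) (g 0) < - g 0" using e(2)[of r] by auto
  then show False using r(2) neg by (simp add: dist_real_def)
qed

text \<open>
  At boundary points \<open>Dv\<close> and \<open>D2v\<close> are only limits of derivatives taken inside \<open>\<Omega>\<close>. Restricting \<open>v\<close> to
  a ray that enters \<open>\<Omega>\<close>, the mean value theorem produces interior points arbitrarily close to \<open>x\<close> with
  the required sign, and continuity passes it to \<open>x\<close>.
\<close>

lemma min_inward_direction:
  fixes v :: "real^'n \<Rightarrow> real" and Dv :: "real^'n \<Rightarrow> real^'n" and D2v :: "real^'n \<Rightarrow> real^'n^'n"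
  assumes \<Omega>: "open \<Omega>" and pd: "\<And>x j. x \<in> \<Omega> \<Longrightarrow> has_partial_derivative v j (Dv x $ j) x"
    and pd2: "\<And>x i j. x \<in> \<Omega> \<Longrightarrow> has_partial_derivative (\<lambda>y. Dv y $ j) i (D2v x $ i $ j) x"
    and cont: "continuous_on (closure \<Omega>) v" "continuous_on (closure \<Omega>) Dv" "continuous_on (closure \<Omega>) D2v"
    and x: "x \<in> closure \<Omega>" and min: "\<And>y. y \<in> closure \<Omega> \<Longrightarrow> v x \<le> v y"
    and inward: "\<forall>\<^sub>F s in at_right 0. x + s *\<^sub>R h \<in> \<Omega>"
  shows "0 \<le> Dv x \<bullet> h"
    and "Dv x \<bullet> h = 0 \<Longrightarrow> 0 \<le> (\<Sum>i\<in>UNIV. \<Sum>j\<in>UNIV. D2v x $ i $ j * h $ i * h $ j)"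
proof -
  obtain d where d: "d > 0" "\<And>s. 0 < s \<Longrightarrow> s < d \<Longrightarrow> x + s *\<^sub>R h \<in> \<Omega>"
    using inward unfolding eventually_at_right_field by blast
  have cl: "x + s *\<^sub>R h \<in> closure \<Omega>" if "s \<in> {0..<d}" for s
    using that d(2)[of s] x closure_subset[of \<Omega>] by (cases "s = 0") auto
  have line: "continuous_on {0..<d} (\<lambda>s. F (x + s *\<^sub>R h))" if "continuous_on (closure \<Omega>) F"
    for F :: "real^'n \<Rightarrow> 'c::topological_space"
  proof (rule continuous_on_compose2[OF that])
    show "continuous_on {0..<d} (\<lambda>s. x + s *\<^sub>R h)" by (intro continuous_intros)
  qed (use cl in blast)
  define \<phi> where "\<phi> s = v (x + s *\<^sub>R h)" for s
  define g where "g s = Dv (x + s *\<^sub>R h) \<bullet> h" for s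
  define q where "q s = (\<Sum>i\<in>UNIV. \<Sum>j\<in>UNIV. D2v (x + s *\<^sub>R h) $ i $ j * h $ i * h $ j)" for s
  have c\<phi>: "continuous_on {0..<d} \<phi>" unfolding \<phi>_def by (rule line[OF cont(1)])
  have cg: "continuous_on {0..<d} g"
    unfolding g_def by (intro continuous_intros line[OF cont(2)])
  have cq: "continuous_on {0..<d} q"
    unfolding q_def by (intro continuous_intros line[OF cont(3)])
  have chain: "((\<lambda>s. F (x + s *\<^sub>R h)) has_derivative (\<lambda>r. DF \<bullet> (r *\<^sub>R h))) (at s)"
    if "(F has_derivative (\<lambda>k. DF \<bullet> k)) (at (x + s *\<^sub>R h))" for F :: "real^'n \<Rightarrow> real" and DF s
  proof -
    have "((\<lambda>s. x + s *\<^sub>R h) has_derivative (\<lambda>r. r *\<^sub>R h)) (at s)"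
      by (auto intro!: derivative_eq_intros)
    from has_derivative_compose[OF this that] show ?thesis .
  qed
  have c1: "continuous_on \<Omega> Dv" and c2: "continuous_on \<Omega> D2v"
    using continuous_on_subset[OF cont(2) closure_subset] continuous_on_subset[OF cont(3) closure_subset] .
  have d\<phi>: "(\<phi> has_derivative (\<lambda>r. r * g s)) (at s)" if "0 < s" "s < d" for s
    using chain[OF has_derivative_continuous_partials[OF \<Omega> pd c1 d(2)[OF that]]]
    by (simp add: \<phi>_def[abs_def] g_def)
  have dg: "(g has_derivative (\<lambda>r. r * q s)) (at s)" if s: "0 < s" "s < d" for s
  proof -
    have "((\<lambda>y. Dv y $ j) has_derivative (\<lambda>k. (\<chi> i. D2v (x + s *\<^sub>R h) $ i $ j) \<bullet> k)) (at (x + s *\<^sub>R h))" for j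
    proof (rule has_derivative_continuous_partials[OF \<Omega> _ _ d(2)[OF s]])
      show "has_partial_derivative (\<lambda>y. Dv y $ j) i ((\<chi> i. D2v y $ i $ j) $ i) y" if "y \<in> \<Omega>" for y i
        using pd2[OF that, of j i] by simp
      show "continuous_on \<Omega> (\<lambda>y. \<chi> i. D2v y $ i $ j)"
        by (intro continuous_on_vec_lambda continuous_on_component c2)
    qed
    from chain[OF this]
    have "((\<lambda>s. \<Sum>j\<in>UNIV. Dv (x + s *\<^sub>R h) $ j * h $ j) has_derivative
        (\<lambda>r. \<Sum>j\<in>UNIV. (\<chi> i. D2v (x + s *\<^sub>R h) $ i $ j) \<bullet> (r *\<^sub>R h) * h $ j)) (at s)"
      by (intro has_derivative_sum has_derivative_mult_left)
    moreover have "(\<lambda>s. \<Sum>j\<in>UNIV. Dv (x + s *\<^sub>R h) $ j * h $ j) = g"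
      by (auto simp: g_def inner_vec_def)
    moreover have "(\<lambda>r. \<Sum>j\<in>UNIV. (\<chi> i. D2v (x + s *\<^sub>R h) $ i $ j) \<bullet> (r *\<^sub>R h) * h $ j) = (\<lambda>r. r * q s)"
    proof
      fix r
      have "q s = (\<Sum>j\<in>UNIV. \<Sum>i\<in>UNIV. D2v (x + s *\<^sub>R h) $ i $ j * h $ i * h $ j)"
        unfolding q_def by (rule sum.swap)
      then show "(\<Sum>j\<in>UNIV. (\<chi> i. D2v (x + s *\<^sub>R h) $ i $ j) \<bullet> (r *\<^sub>R h) * h $ j) = r * q s"
        by (simp add: inner_vec_def sum_distrib_left sum_distrib_right mult_ac)
    qed
    ultimately show ?thesis by simp
  qed
  have g_pos: "\<exists>r\<in>{0<..<s}. 0 \<le> g r" if s: "0 < s" "s < d" for s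
  proof -
    obtain r where r: "r \<in> {0<..<s}" "\<phi> s - \<phi> 0 = (s - 0) * g r"
    proof -
      have "continuous_on {0..s} \<phi>" by (rule continuous_on_subset[OF c\<phi>]) (use s in auto)
      then have "\<exists>r\<in>{0<..<s}. \<phi> s - \<phi> 0 = (s - 0) * g r"
        by (rule mvt[OF s(1), where f' = "\<lambda>s r. r * g s"]) (use d\<phi> s(2) in \<open>auto intro!: bexI\<close>)
      then show ?thesis using that by blast
    qed
    have "\<phi> 0 \<le> \<phi> s" using min[OF cl[of s]] s by (simp add: \<phi>_def)
    then have "0 \<le> s * g r" using r(2) by simp
    then show ?thesis using r(1) s(1) by (auto simp: zero_le_mult_iff)
  qed
  have "0 \<le> g 0" by (rule right_limit_nonneg[OF d(1) cg g_pos])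
  then show "0 \<le> Dv x \<bullet> h" unfolding g_def by simp
  assume "Dv x \<bullet> h = 0"
  then have g0: "g 0 = 0" by (simp add: g_def)
  have "0 \<le> q 0"
  proof (rule right_limit_nonneg[OF d(1) cq])
    fix s assume s: "0 < s" "s < d"
    obtain r where r: "0 < r" "r < s" "0 \<le> g r" using g_pos[OF s] by auto
    obtain r' where r': "r' \<in> {0<..<r}" "g r - g 0 = (r - 0) * q r'"
    proof -
      have "continuous_on {0..r} g" by (rule continuous_on_subset[OF cg]) (use s r in auto)
      then have "\<exists>r'\<in>{0<..<r}. g r - g 0 = (r - 0) * q r'"
        by (rule mvt[OF r(1), where f' = "\<lambda>s r. r * q s"]) (use dg s(2) r(2) in \<open>auto intro!: bexI\<close>)
      then show ?thesis using that by blast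
    qed
    then have "0 \<le> r * q r'" using r(3) g0 by simp
    then show "\<exists>r\<in>{0<..<s}. 0 \<le> q r" using r r'(1) by (auto simp: zero_le_mult_iff)
  qed
  then show "0 \<le> (\<Sum>i\<in>UNIV. \<Sum>j\<in>UNIV. D2v x $ i $ j * h $ i * h $ j)" by (simp add: q_def)
qed

text \<open>
  The set of inward directions at a boundary point contains an open half space, and \<open>- \<omega>\<close> lies in it.
  Both \<open>Dv x \<bullet> (- \<omega>) \<ge> 0\<close> and \<open>\<omega> \<bullet> Dv x \<ge> 0\<close> hold, so the linear functional \<open>Dv x\<close>, which is nonnegative on the
  half space, vanishes at an interior point of it and is therefore zero. The second order form is even,
  so nonnegativity on the half space gives it off the tangent hyperplane, and by continuity everywhere.
\<close>

lemma min_critical_point: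
  fixes v :: "real^'n \<Rightarrow> real" and Dv :: "real^'n \<Rightarrow> real^'n" and D2v :: "real^'n \<Rightarrow> real^'n^'n"
  assumes \<Omega>: "open \<Omega>" and pd: "\<And>x j. x \<in> \<Omega> \<Longrightarrow> has_partial_derivative v j (Dv x $ j) x"
    and pd2: "\<And>x i j. x \<in> \<Omega> \<Longrightarrow> has_partial_derivative (\<lambda>y. Dv y $ j) i (D2v x $ i $ j) x"
    and cont: "continuous_on (closure \<Omega>) v" "continuous_on (closure \<Omega>) Dv" "continuous_on (closure \<Omega>) D2v"
    and x: "x \<in> closure \<Omega>" and min: "\<And>y. y \<in> closure \<Omega> \<Longrightarrow> v x \<le> v y"
    and pos: "x \<in> \<Omega> \<or>
      (\<exists>\<nu> \<omega>. x \<in> frontier \<Omega> \<and> is_outer_normal \<Omega> x \<nu> \<and> 0 < \<omega> \<bullet> \<nu> \<and> 0 \<le> \<omega> \<bullet> Dv x)"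
  shows "Dv x = 0 \<and> (\<forall>h. 0 \<le> (\<Sum>i\<in>UNIV. \<Sum>j\<in>UNIV. D2v x $ i $ j * h $ i * h $ j))"
proof -
  define Q where "Q h = (\<Sum>i\<in>UNIV. \<Sum>j\<in>UNIV. D2v x $ i $ j * h $ i * h $ j)" for h
  have dir1: "0 \<le> Dv x \<bullet> h" if "\<forall>\<^sub>F s in at_right 0. x + s *\<^sub>R h \<in> \<Omega>" for h
    using min_inward_direction(1)[OF \<Omega> pd pd2 cont x min that] by simp
  have dir2: "0 \<le> Q h" if "\<forall>\<^sub>F s in at_right 0. x + s *\<^sub>R h \<in> \<Omega>" "Dv x = 0" for h
    using min_inward_direction(2)[OF \<Omega> pd pd2 cont x min that(1)] that(2) by (simp add: Q_def)
  show ?thesis unfolding Q_def[symmetric]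
    using pos
  proof (elim disjE exE conjE)
    assume "x \<in> \<Omega>"
    have inw: "\<forall>\<^sub>F s in at_right 0. x + s *\<^sub>R h \<in> \<Omega>" for h
    proof -
      have "((\<lambda>s. x + s *\<^sub>R h) \<longlongrightarrow> x + 0 *\<^sub>R h) (at_right 0)" by (intro tendsto_intros)
      then show ?thesis using \<Omega> \<open>x \<in> \<Omega>\<close> by (intro topological_tendstoD) auto
    qed
    have 0: "Dv x = 0" using dir1[OF inw[of "- Dv x"]]
      by (metis inner_gt_zero_iff inner_minus_right linorder_not_le neg_0_le_iff_le)
    then show "Dv x = 0 \<and> (\<forall>h. 0 \<le> Q h)" using dir2[OF inw] by simp
  next
    fix \<nu> \<omega> assume fr: "x \<in> frontier \<Omega>" and \<nu>: "is_outer_normal \<Omega> x \<nu>"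
      and \<omega>: "0 < \<omega> \<bullet> \<nu>" "0 \<le> \<omega> \<bullet> Dv x"
    obtain U \<phi> D\<phi> where ldf: "local_defining_function \<Omega> x U \<phi> D\<phi>" and \<nu>eq: "\<nu> = D\<phi> x /\<^sub>R norm (D\<phi> x)"
      using \<nu> by (auto simp: is_outer_normal_def)
    define N where "N = D\<phi> x"
    have N: "N \<noteq> 0" using ldf by (auto simp: local_defining_function_def N_def)
    have \<omega>N: "N \<bullet> \<omega> > 0"
      using \<omega>(1) N by (simp add: \<nu>eq N_def[symmetric] inner_commute zero_less_mult_iff)
    have inw: "\<forall>\<^sub>F s in at_right 0. x + s *\<^sub>R h \<in> \<Omega>" if "N \<bullet> h < 0" for h
      using local_defining_function_descent[OF ldf local_defining_function_zero[OF ldf fr \<Omega>] that[unfolded N_def]]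
      by (rule eventually_mono) (use ldf in \<open>auto simp: local_defining_function_def\<close>)
    have "0 \<le> Dv x \<bullet> h" for h
    proof -
      \<comment> \<open>Small enough that \<open>e *\<^sub>R h - \<omega>\<close> still points inward.\<close>
      define e where "e = (N \<bullet> \<omega>) / (2 * (\<bar>N \<bullet> h\<bar> + 1))"
      have e: "e > 0" using \<omega>N by (simp add: e_def)
      have "e * (N \<bullet> h) \<le> e * (\<bar>N \<bullet> h\<bar> + 1)" using e by (intro mult_left_mono) auto
      also have "\<dots> = (N \<bullet> \<omega>) / 2" by (simp add: e_def field_simps)
      finally have "N \<bullet> (e *\<^sub>R h - \<omega>) < 0" using \<omega>N by (simp add: inner_diff_right)
      then have "0 \<le> Dv x \<bullet> (e *\<^sub>R h - \<omega>)" by (intro dir1 inw)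
      then have "0 \<le> e * (Dv x \<bullet> h)" using \<omega>(2) by (simp add: inner_diff_right inner_commute)
      then show ?thesis using e by (simp add: zero_le_mult_iff)
    qed
    from this[of "- Dv x"] have 0: "Dv x = 0"
      by (metis inner_gt_zero_iff inner_minus_right linorder_not_le neg_0_le_iff_le)
    have neg: "0 \<le> Q h" if "N \<bullet> h < 0" for h
      using dir2[OF inw[OF that]] 0 by simp
    have half: "0 \<le> Q h" if "N \<bullet> h \<le> 0" for h
    proof (rule tendsto_lowerbound)
      show "((\<lambda>s. Q (h - s *\<^sub>R N)) \<longlongrightarrow> Q h) (at_right 0)"
      proof -
        have "((\<lambda>s. Q (h - s *\<^sub>R N)) \<longlongrightarrow> Q (h - 0 *\<^sub>R N)) (at_right 0)"
          unfolding Q_def by (intro tendsto_intros)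
        then show ?thesis by simp
      qed
      show "\<forall>\<^sub>F s in at_right 0. 0 \<le> Q (h - s *\<^sub>R N)"
        using eventually_at_right_less[of "0::real"]
      proof eventually_elim
        case (elim s)
        have "0 < s * (N \<bullet> N)" using elim N by simp
        then show ?case using that by (intro neg) (simp add: inner_diff_right)
      qed
    qed simp
    have "0 \<le> Q h" for h
    proof (cases "N \<bullet> h \<le> 0")
      case False
      then have "0 \<le> Q (- h)" by (intro half) simp
      then show ?thesis by (simp add: Q_def)
    qed (rule half)
    then show "Dv x = 0 \<and> (\<forall>h. 0 \<le> Q h)" using 0 by simp
  qed
qed

lemma elliptic_op_nonneg_at_min:
  fixes v :: "real^'n \<Rightarrow> real" and Dv :: "real^'n \<Rightarrow> real^'n" and D2v :: "real^'n \<Rightarrow> real^'n^'n"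
  assumes \<Omega>: "open \<Omega>" and pd: "\<And>x j. x \<in> \<Omega> \<Longrightarrow> has_partial_derivative v j (Dv x $ j) x"
    and pd2: "\<And>x i j. x \<in> \<Omega> \<Longrightarrow> has_partial_derivative (\<lambda>y. Dv y $ j) i (D2v x $ i $ j) x"
    and cont: "continuous_on (closure \<Omega>) v" "continuous_on (closure \<Omega>) Dv" "continuous_on (closure \<Omega>) D2v"
    and a: "continuous_on (closure \<Omega>) a" "uniformly_elliptic \<Omega> a"
    and x: "x \<in> closure \<Omega>" and min: "\<And>y. y \<in> closure \<Omega> \<Longrightarrow> v x \<le> v y"
    and pos: "x \<in> \<Omega> \<or>
      (\<exists>\<nu> \<omega>. x \<in> frontier \<Omega> \<and> is_outer_normal \<Omega> x \<nu> \<and> 0 < \<omega> \<bullet> \<nu> \<and> 0 \<le> \<omega> \<bullet> Dv x)"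
  shows "0 \<le> elliptic_op a b x (Dv x) (D2v x)"
proof -
  have crit: "Dv x = 0" "0 \<le> (\<Sum>i\<in>UNIV. \<Sum>j\<in>UNIV. D2v x $ i $ j * h $ i * h $ j)" for h
    using min_critical_point[OF \<Omega> pd pd2 cont x min pos] by auto
  have "D2v x $ i $ j - D2v x $ j $ i \<in> {0}" for i j
    by (rule continuous_on_closed_property[where S = "closure \<Omega>" and A = \<Omega>
          and F = "\<lambda>y. D2v y $ i $ j - D2v y $ j $ i"])
       (use x closure_subset mixed_partials_commute[OF \<Omega> pd pd2 continuous_on_subset[OF cont(3) closure_subset]]
        in \<open>auto intro!: continuous_intros cont(3)\<close>)
  then have sym: "D2v x $ i $ j = D2v x $ j $ i" for i j by simp
  have psd: "0 \<le> (\<Sum>i\<in>UNIV. \<Sum>j\<in>UNIV. a x $ i $ j * \<xi> $ i * \<xi> $ j)" for \<xi> :: "real^'n"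
  proof -
    obtain c where c: "c > 0" "\<And>y \<xi>. y \<in> \<Omega> \<Longrightarrow> c * (norm \<xi>)\<^sup>2 \<le> (\<Sum>i\<in>UNIV. \<Sum>j\<in>UNIV. a y $ i $ j * \<xi> $ i * \<xi> $ j)"
      using a(2) by (auto simp: uniformly_elliptic_def)
    have "(\<Sum>i\<in>UNIV. \<Sum>j\<in>UNIV. a x $ i $ j * \<xi> $ i * \<xi> $ j) \<in> {0..}"
    proof (rule continuous_on_closed_property[where S = "closure \<Omega>" and A = \<Omega>
          and F = "\<lambda>y. \<Sum>i\<in>UNIV. \<Sum>j\<in>UNIV. a y $ i $ j * \<xi> $ i * \<xi> $ j"])
      show "(\<Sum>i\<in>UNIV. \<Sum>j\<in>UNIV. a y $ i $ j * \<xi> $ i * \<xi> $ j) \<in> {0..}" if "y \<in> \<Omega>" for y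
        using order_trans[OF mult_nonneg_nonneg c(2)[OF that, of \<xi>]] c(1) by simp
    qed (use x closure_subset in \<open>auto intro!: continuous_intros a(1)\<close>)
    then show ?thesis by simp
  qed
  have "0 \<le> (\<Sum>i\<in>UNIV. \<Sum>j\<in>UNIV. a x $ i $ j * D2v x $ i $ j)"
    by (rule psd_trace_nonneg[OF psd crit(2) sym])
  then show ?thesis using crit(1) by (simp add: elliptic_op_def)
qed

section \<open>Convolution with a decreasing kernel\<close>

definition kernel_primitive :: "(real \<Rightarrow> real) \<Rightarrow> real \<Rightarrow> real" where
  "kernel_primitive k t = (LBINT \<tau>:{0<..<t}. k \<tau>)"

text \<open>
  Reflecting the integration variable about \<open>t\<close> rather than about \<open>t - e\<close> puts \<open>conv k v t\<close> and
  \<open>conv k v (t - e)\<close> over the same factor \<open>v (t - \<tau>)\<close>, so that their difference only involves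
  \<open>k (\<tau> - e) - k \<tau>\<close>.
\<close>

lemma conv_shift:
  "conv k v (t - e) = (LBINT \<tau>:{e<..<t}. k (\<tau> - e) * v (t - \<tau>))"
proof -
  have "conv k v (t - e) =
      (LBINT \<tau>. indicator {0<..<t - e} (t + - 1 * \<tau>) *\<^sub>R (k (t - e - (t + - 1 * \<tau>)) * v (t + - 1 * \<tau>)))"
    unfolding conv_def set_lebesgue_integral_def
    by (subst lborel_integral_real_affine[of "-1" "\<lambda>\<tau>. indicator {0<..<t - e} \<tau> *\<^sub>R (k (t - e - \<tau>) * v \<tau>)" t])
       simp_all
  also have "\<dots> = (LBINT \<tau>:{e<..<t}. k (\<tau> - e) * v (t - \<tau>))"
    unfolding set_lebesgue_integral_def
    by (intro Bochner_Integration.integral_cong refl) (auto simp: indicator_def)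
  finally show ?thesis .
qed

locale decreasing_kernel =
  fixes T :: real and k :: "real \<Rightarrow> real"
  assumes T_pos: "0 < T"
    and integrable: "set_integrable lborel {0<..<T} k"
    and continuous: "continuous_on {0<..T} k"
    and positive: "\<And>t. t \<in> {0<..T} \<Longrightarrow> 0 < k t"
    and antimono: "antimono_on {0<..T} k"
begin

lemma kernel_antimono: "0 < s \<Longrightarrow> s \<le> t \<Longrightarrow> t \<le> T \<Longrightarrow> k t \<le> k s"
  using monotone_onD[OF antimono, of s t] by simp

lemma integrable_mult:
  assumes "t \<le> T" "continuous_on {0..t} w"
  shows "set_integrable lborel {0<..<t} (\<lambda>\<tau>. k \<tau> * w \<tau>)"
proof -
  have k: "set_integrable lborel {0<..<t} k"
    by (rule set_integrable_subset[OF integrable]) (use assms(1) in auto)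
  have "bounded (w ` {0..t})"
    by (rule compact_imp_bounded[OF compact_continuous_image[OF assms(2)]]) simp
  then obtain B where "\<forall>y\<in>w ` {0..t}. norm y \<le> B"
    unfolding bounded_iff by (elim exE)
  then have B: "norm (w \<tau>) \<le> B" if "\<tau> \<in> {0..t}" for \<tau> using that by simp
  have "continuous_on {0<..<t} w"
    by (rule continuous_on_subset[OF assms(2)]) auto
  then have m: "(\<lambda>\<tau>. indicator {0<..<t} \<tau> *\<^sub>R w \<tau>) \<in> borel_measurable lborel"
    using borel_measurable_continuous_on_indicator[of "{0<..<t}" w] by simp
  have "integrable lborel (\<lambda>\<tau>. indicator {0<..<t} \<tau> *\<^sub>R k \<tau> * (indicator {0<..<t} \<tau> *\<^sub>R w \<tau>))"
  proof (rule Bochner_Integration.integrable_bound)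
    show "integrable lborel (\<lambda>\<tau>. B * (indicator {0<..<t} \<tau> *\<^sub>R k \<tau>))"
      using k unfolding set_integrable_def by simp
    have "(\<lambda>\<tau>. indicator {0<..<t} \<tau> *\<^sub>R k \<tau>) \<in> borel_measurable lborel"
      using k unfolding set_integrable_def by (rule borel_measurable_integrable)
    then show "(\<lambda>\<tau>. indicator {0<..<t} \<tau> *\<^sub>R k \<tau> * (indicator {0<..<t} \<tau> *\<^sub>R w \<tau>)) \<in> borel_measurable lborel"
      using m by (rule borel_measurable_times)
    show "AE \<tau> in lborel. norm (indicator {0<..<t} \<tau> *\<^sub>R k \<tau> * (indicator {0<..<t} \<tau> *\<^sub>R w \<tau>))
        \<le> norm (B * (indicator {0<..<t} \<tau> *\<^sub>R k \<tau>))"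
    proof (rule AE_I2)
      fix \<tau>
      show "norm (indicator {0<..<t} \<tau> *\<^sub>R k \<tau> * (indicator {0<..<t} \<tau> *\<^sub>R w \<tau>))
          \<le> norm (B * (indicator {0<..<t} \<tau> *\<^sub>R k \<tau>))"
      proof (cases "\<tau> \<in> {0<..<t}")
        case True
        then have "\<bar>w \<tau>\<bar> \<le> \<bar>B\<bar>" using B[of \<tau>] by auto
        then have "\<bar>k \<tau>\<bar> * \<bar>w \<tau>\<bar> \<le> \<bar>B\<bar> * \<bar>k \<tau>\<bar>"
          using mult_right_mono[of "\<bar>w \<tau>\<bar>" "\<bar>B\<bar>" "\<bar>k \<tau>\<bar>"] by (simp add: mult.commute)
        then show ?thesis using True by (simp add: abs_mult)
      qed simp
    qed
  qed
  moreover have "(\<lambda>\<tau>. indicator {0<..<t} \<tau> *\<^sub>R k \<tau> * (indicator {0<..<t} \<tau> *\<^sub>R w \<tau>)) =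
      (\<lambda>\<tau>. indicator {0<..<t} \<tau> *\<^sub>R (k \<tau> * w \<tau>))"
    by (simp add: indicator_def fun_eq_iff)
  ultimately show ?thesis unfolding set_integrable_def by simp
qed

lemma integrable_mult_shift:
  assumes "0 \<le> e" "t \<le> T" "continuous_on {0..t} w"
  shows "set_integrable lborel {e<..<t} (\<lambda>\<tau>. k (\<tau> - e) * w \<tau>)"
proof -
  have "continuous_on {0..t - e} (\<lambda>\<sigma>. w (\<sigma> + e))"
    by (rule continuous_on_compose2[OF assms(3)]) (use assms(1) in \<open>auto intro!: continuous_intros\<close>)
  then have "set_integrable lborel {0<..<t - e} (\<lambda>\<sigma>. k \<sigma> * w (\<sigma> + e))"
    using assms by (intro integrable_mult) auto
  then have "integrable lborel (\<lambda>\<tau>. indicator {0<..<t - e} (- e + 1 * \<tau>) *\<^sub>R (k (- e + 1 * \<tau>) * w (- e + 1 * \<tau> + e)))"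
    unfolding set_integrable_def by (rule lborel_integrable_real_affine) simp
  moreover have "(\<lambda>\<tau>. indicator {0<..<t - e} (- e + 1 * \<tau>) *\<^sub>R (k (- e + 1 * \<tau>) * w (- e + 1 * \<tau> + e))) =
      (\<lambda>\<tau>. indicator {e<..<t} \<tau> *\<^sub>R (k (\<tau> - e) * w \<tau>))"
    by (auto simp: indicator_def fun_eq_iff)
  ultimately show ?thesis unfolding set_integrable_def by simp
qed

lemma integrable_shift:
  assumes "0 \<le> e" "e \<le> s" "t \<le> T"
  shows "set_integrable lborel {s<..<t} (\<lambda>\<tau>. k (\<tau> - e))"
proof -
  have "set_integrable lborel {e<..<t} (\<lambda>\<tau>. k (\<tau> - e) * 1)"
    using assms by (intro integrable_mult_shift) auto
  then have "set_integrable lborel {e<..<t} (\<lambda>\<tau>. k (\<tau> - e))" by simp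
  then show ?thesis by (rule set_integrable_subset) (use assms in auto)
qed

lemma kernel_primitive_diff:
  assumes "0 \<le> e" "e \<le> s" "s \<le> t" "t \<le> T"
  shows "(LBINT \<tau>:{s<..<t}. k (\<tau> - e)) = kernel_primitive k (t - e) - kernel_primitive k (s - e)"
proof -
  have P: "kernel_primitive k (r - e) = (LBINT \<tau>:{e<..<r}. k (\<tau> - e))" for r
    using conv_shift[of "\<lambda>\<tau>. k \<tau>" "\<lambda>_. 1" r e] conv_shift[of "\<lambda>\<tau>. k \<tau>" "\<lambda>_. 1" "r - e" 0]
    by (simp add: kernel_primitive_def)
  have i: "set_integrable lborel {e<..<s} (\<lambda>\<tau>. k (\<tau> - e))" "set_integrable lborel {s<..<t} (\<lambda>\<tau>. k (\<tau> - e))"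
    using assms by (auto intro!: integrable_shift)
  have "(LBINT \<tau>:{e<..<t}. k (\<tau> - e)) =
      (LBINT \<tau>. indicator {e<..<s} \<tau> *\<^sub>R k (\<tau> - e) + indicator {s<..<t} \<tau> *\<^sub>R k (\<tau> - e))"
    unfolding set_lebesgue_integral_def
  proof (rule integral_cong_AE)
    show "(\<lambda>\<tau>. indicator {e<..<t} \<tau> *\<^sub>R k (\<tau> - e)) \<in> borel_measurable lborel"
      using integrable_shift[of e e t] assms
      by (intro borel_measurable_integrable) (auto simp: set_integrable_def)
    show "(\<lambda>\<tau>. indicator {e<..<s} \<tau> *\<^sub>R k (\<tau> - e) + indicator {s<..<t} \<tau> *\<^sub>R k (\<tau> - e)) \<in> borel_measurable lborel"
      using i unfolding set_integrable_def
      by (intro borel_measurable_integrable Bochner_Integration.integrable_add)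
    show "AE \<tau> in lborel. indicator {e<..<t} \<tau> *\<^sub>R k (\<tau> - e) =
        indicator {e<..<s} \<tau> *\<^sub>R k (\<tau> - e) + indicator {s<..<t} \<tau> *\<^sub>R k (\<tau> - e)"
      using AE_lborel_singleton[of s]
      by eventually_elim (use assms in \<open>auto simp: indicator_def\<close>)
  qed
  also have "\<dots> = (LBINT \<tau>:{e<..<s}. k (\<tau> - e)) + (LBINT \<tau>:{s<..<t}. k (\<tau> - e))"
    using i unfolding set_integrable_def set_lebesgue_integral_def
    by (rule Bochner_Integration.integral_add)
  finally show ?thesis unfolding P by simp
qed

lemma kernel_primitive_increment_upper:
  assumes "0 < s" "s \<le> t" "t \<le> T"
  shows "kernel_primitive k t - kernel_primitive k s \<le> (t - s) * k s"
proof -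
  have "(LBINT \<tau>:{s<..<t}. k (\<tau> - 0)) \<le> (LBINT \<tau>:{s<..<t}. k s)"
    by (rule set_integral_mono)
       (use assms integrable_shift[of 0 s t] kernel_antimono in \<open>auto simp: set_integrable_def\<close>)
  then show ?thesis
    using kernel_primitive_diff[of 0 s t] assms by (simp add: set_integral_const)
qed

lemma kernel_primitive_increment_lower:
  assumes "0 \<le> s" "s \<le> t" "t \<le> T"
  shows "(t - s) * k t \<le> kernel_primitive k t - kernel_primitive k s"
proof -
  have "(LBINT \<tau>:{s<..<t}. k t) \<le> (LBINT \<tau>:{s<..<t}. k (\<tau> - 0))"
    by (rule set_integral_mono)
       (use assms integrable_shift[of 0 s t] kernel_antimono in \<open>auto simp: set_integrable_def\<close>)
  then show ?thesis
    using kernel_primitive_diff[of 0 s t] assms by (simp add: set_integral_const)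
qed

lemma kernel_primitive_0 [simp]: "kernel_primitive k 0 = 0"
  by (simp add: kernel_primitive_def set_lebesgue_integral_def)

lemma kernel_primitive_nonneg:
  assumes "0 \<le> t" "t \<le> T"
  shows "0 \<le> kernel_primitive k t"
proof (cases "t = 0")
  case False
  then have "0 \<le> (t - 0) * k t" using assms positive[of t] by simp
  then show ?thesis using kernel_primitive_increment_lower[of 0 t] assms by simp
qed simp

lemma abs_conv_le:
  assumes "0 \<le> t" "t \<le> T" "continuous_on {0..t} v" "\<And>s. s \<in> {0..t} \<Longrightarrow> \<bar>v s\<bar> \<le> B"
  shows "\<bar>conv k v t\<bar> \<le> B * kernel_primitive k t"
proof -
  have c: "continuous_on {0..t} (\<lambda>\<tau>. v (t - \<tau>))"
    by (rule continuous_on_compose2[OF assms(3)]) (auto intro!: continuous_intros)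
  have i: "set_integrable lborel {0<..<t} (\<lambda>\<tau>. k \<tau> * v (t - \<tau>))"
    by (rule integrable_mult[OF assms(2) c])
  have ik: "set_integrable lborel {0<..<t} k"
    using integrable_shift[of 0 0 t] assms by simp
  have "\<bar>conv k v t\<bar> = \<bar>LBINT \<tau>:{0<..<t}. k \<tau> * v (t - \<tau>)\<bar>"
    using conv_shift[of k v t 0] by simp
  also have "\<dots> \<le> (LBINT \<tau>:{0<..<t}. \<bar>k \<tau> * v (t - \<tau>)\<bar>)"
    using set_integral_norm_bound[OF i] by simp
  also have "\<dots> \<le> (LBINT \<tau>:{0<..<t}. B * k \<tau>)"
  proof (rule set_integral_mono)
    fix \<tau> assume \<tau>: "\<tau> \<in> {0<..<t}"
    then have "\<bar>v (t - \<tau>)\<bar> * k \<tau> \<le> B * k \<tau>"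
      using assms(2,4) positive[of \<tau>] by (intro mult_right_mono) auto
    then show "\<bar>k \<tau> * v (t - \<tau>)\<bar> \<le> B * k \<tau>"
      using \<tau> assms(2) positive[of \<tau>] by (simp add: abs_mult mult.commute)
  qed (use i ik in \<open>auto intro: set_integrable_abs\<close>)
  finally show ?thesis by (simp add: kernel_primitive_def)
qed

lemma conv_diff:
  assumes "0 \<le> t" "t \<le> T" "continuous_on {0..t} v" "continuous_on {0..t} w"
  shows "conv k (\<lambda>s. v s - w s) t = conv k v t - conv k w t"
proof -
  have "set_integrable lborel {0<..<t} (\<lambda>\<tau>. k \<tau> * z (t - \<tau>))" if "continuous_on {0..t} z" for z
    by (intro integrable_mult assms(2) continuous_on_compose2[OF that]) (auto intro!: continuous_intros)
  from set_integral_diff(2)[OF this[OF assms(3)] this[OF assms(4)]]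
  show ?thesis
    using conv_shift[of k _ t 0] by (simp add: right_diff_distrib)
qed

lemma conv_const: "conv k (\<lambda>_. c) t = c * kernel_primitive k t"
  using conv_shift[of k "\<lambda>_. c" t 0] by (simp add: kernel_primitive_def mult.commute)

text \<open>
  With \<open>w \<tau> = v (t0 - \<tau>) - v t0 \<ge> 0\<close>, the increment of the convolution consists of the contribution of the constant
  \<open>v t0\<close>, the integral of \<open>k * w\<close> over lags below \<open>e\<close>, and minus the integral of
  \<open>(k (\<tau> - e) - k \<tau>) * w \<tau>\<close> over the other lags. The last integrand is nonnegative since \<open>k\<close> decreases; it is
  bounded below by \<open>m * (k (\<tau> - e) - k \<tau>)\<close> on \<open>{p..q}\<close> and by 0 elsewhere. The bounds for the increments
  of the primitive of \<open>k\<close> turn the integrals into values of \<open>k\<close>.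
\<close>

lemma conv_increment_le:
  assumes t0: "t0 \<le> T" and v: "continuous_on {0..T} v"
    and e: "0 < e" "e < p" and pq: "p \<le> q" "q \<le> t0"
    and neg: "v t0 \<le> 0" and min: "\<And>s. s \<in> {0..t0} \<Longrightarrow> v t0 \<le> v s"
    and m: "0 \<le> m" "\<And>\<tau>. \<tau> \<in> {p..q} \<Longrightarrow> v t0 + m \<le> v (t0 - \<tau>)"
    and S: "\<And>s. s \<in> {0..e} \<Longrightarrow> \<bar>v (t0 - s) - v t0\<bar> \<le> S"
  shows "conv k v t0 - conv k v (t0 - e) \<le>
      e * (v t0 * k t0) + kernel_primitive k e * S + e * (m * (k (q - e) - k p))"
proof -
  define w where "w \<tau> = v (t0 - \<tau>) - v t0" for \<tau>
  have cv: "continuous_on {0..t0} (\<lambda>\<tau>. v (t0 - \<tau>))"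
    by (rule continuous_on_compose2[OF v]) (use t0 in \<open>auto intro!: continuous_intros\<close>)
  then have cw: "continuous_on {0..t0} w"
    unfolding w_def by (intro continuous_intros)
  \<comment> \<open>The integrands are compared on the whole line, away from the null set \<open>{e}\<close>.\<close>
  define I1 where "I1 \<tau> = indicator {0<..<t0} \<tau> *\<^sub>R (k \<tau> * v (t0 - \<tau>))" for \<tau>
  define I2 where "I2 \<tau> = indicator {e<..<t0} \<tau> *\<^sub>R (k (\<tau> - e) * v (t0 - \<tau>))" for \<tau>
  define J1 where "J1 \<tau> = indicator {0<..<t0} \<tau> *\<^sub>R k \<tau>" for \<tau>
  define J2 where "J2 \<tau> = indicator {e<..<t0} \<tau> *\<^sub>R k (\<tau> - e)" for \<tau>
  define J3 where "J3 \<tau> = indicator {0<..<e} \<tau> *\<^sub>R (k \<tau> * w \<tau>)" for \<tau>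
  define J4 where "J4 \<tau> = indicator {p<..<q} \<tau> *\<^sub>R k (\<tau> - e)" for \<tau>
  define J5 where "J5 \<tau> = indicator {p<..<q} \<tau> *\<^sub>R k \<tau>" for \<tau>
  have int: "integrable lborel I1" "integrable lborel I2" "integrable lborel J1" "integrable lborel J2"
    "integrable lborel J3" "integrable lborel J4" "integrable lborel J5"
  proof -
    show "integrable lborel I1" "integrable lborel I2"
      using integrable_mult[OF t0 cv] integrable_mult_shift[OF _ t0 cv, of e] e
      by (auto simp: set_integrable_def I1_def[abs_def] I2_def[abs_def])
    have "set_integrable lborel {0<..<e} (\<lambda>\<tau>. k \<tau> * w \<tau>)"
      by (rule set_integrable_subset[OF integrable_mult[OF t0 cw]]) (use e pq in auto)
    then show "integrable lborel J3" by (simp add: set_integrable_def J3_def[abs_def])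
    show "integrable lborel J1" "integrable lborel J2" "integrable lborel J4" "integrable lborel J5"
      using integrable_shift[of 0 0 t0] integrable_shift[of e e t0] integrable_shift[of e p q]
        integrable_shift[of 0 p q] e pq t0
      by (auto simp: set_integrable_def J1_def[abs_def] J2_def[abs_def] J4_def[abs_def] J5_def[abs_def])
  qed
  have "integral\<^sup>L lborel (\<lambda>\<tau>. I1 \<tau> - I2 \<tau>) \<le>
      integral\<^sup>L lborel (\<lambda>\<tau>. v t0 * (J1 \<tau> - J2 \<tau>) + J3 \<tau> - m * (J4 \<tau> - J5 \<tau>))"
  proof (rule integral_mono_AE)
    show "AE \<tau> in lborel. I1 \<tau> - I2 \<tau> \<le> v t0 * (J1 \<tau> - J2 \<tau>) + J3 \<tau> - m * (J4 \<tau> - J5 \<tau>)"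
      using AE_lborel_singleton[of e]
    proof eventually_elim
      case (elim \<tau>)
      consider "\<tau> \<notin> {0<..<t0}" | "\<tau> \<in> {0<..<e}" | "\<tau> \<in> {e<..<t0}" "\<tau> \<in> {p<..<q}" | "\<tau> \<in> {e<..<t0}" "\<tau> \<notin> {p<..<q}"
        using elim by force
      then show ?case
      proof cases
        case 1
        then have "\<tau> \<notin> {e<..<t0}" "\<tau> \<notin> {0<..<e}" "\<tau> \<notin> {p<..<q}" using e pq by auto
        then show ?thesis using 1 by (simp add: I1_def I2_def J1_def J2_def J3_def J4_def J5_def)
      next
        case 2
        then have "\<tau> \<in> {0<..<t0}" "\<tau> \<notin> {e<..<t0}" "\<tau> \<notin> {p<..<q}" using e pq by auto
        then show ?thesis using 2
          by (simp add: I1_def I2_def J1_def J2_def J3_def J4_def J5_def w_def algebra_simps)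
      next
        case 3
        then have "\<tau> \<in> {0<..<t0}" "\<tau> \<notin> {0<..<e}" using e by auto
        moreover have "0 \<le> (k (\<tau> - e) - k \<tau>) * (w \<tau> - m)"
          using 3 e m(2)[of \<tau>] kernel_antimono[of "\<tau> - e" \<tau>] t0 by (intro mult_nonneg_nonneg) (auto simp: w_def)
        ultimately show ?thesis using 3
          by (simp add: I1_def I2_def J1_def J2_def J3_def J4_def J5_def w_def algebra_simps)
      next
        case 4
        then have "\<tau> \<in> {0<..<t0}" "\<tau> \<notin> {0<..<e}" using e by auto
        moreover have "0 \<le> (k (\<tau> - e) - k \<tau>) * w \<tau>"
          using 4 e min[of "t0 - \<tau>"] kernel_antimono[of "\<tau> - e" \<tau>] t0
          by (intro mult_nonneg_nonneg) (auto simp: w_def)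
        ultimately show ?thesis using 4
          by (simp add: I1_def I2_def J1_def J2_def J3_def J4_def J5_def w_def algebra_simps)
      qed
    qed
  qed (use int in auto)
  moreover have "integral\<^sup>L lborel I1 = conv k v t0" "integral\<^sup>L lborel I2 = conv k v (t0 - e)"
    using conv_shift[of k v t0 0] conv_shift[of k v t0 e]
    by (simp_all add: set_lebesgue_integral_def I1_def[abs_def] I2_def[abs_def])
  moreover have "integral\<^sup>L lborel J1 = kernel_primitive k t0"
    "integral\<^sup>L lborel J2 = kernel_primitive k (t0 - e)"
    "integral\<^sup>L lborel J4 = kernel_primitive k (q - e) - kernel_primitive k (p - e)"
    "integral\<^sup>L lborel J5 = kernel_primitive k q - kernel_primitive k p"
    using kernel_primitive_diff[of 0 0 t0] kernel_primitive_diff[of e e t0]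
      kernel_primitive_diff[of e p q] kernel_primitive_diff[of 0 p q] e pq t0
    by (simp_all add: set_lebesgue_integral_def J1_def[abs_def] J2_def[abs_def] J4_def[abs_def] J5_def[abs_def])
  moreover have "integral\<^sup>L lborel J3 \<le> kernel_primitive k e * S"
  proof -
    have "integral\<^sup>L lborel J3 \<le> (LBINT \<tau>:{0<..<e}. k \<tau> * S)"
      unfolding J3_def[abs_def] set_lebesgue_integral_def[symmetric]
    proof (rule set_integral_mono)
      show "set_integrable lborel {0<..<e} (\<lambda>\<tau>. k \<tau> * w \<tau>)"
        using int(5) by (simp add: set_integrable_def J3_def[abs_def])
      show "set_integrable lborel {0<..<e} (\<lambda>\<tau>. k \<tau> * S)"
        using integrable_shift[of 0 0 e] e pq t0 by simp
      fix \<tau> assume \<tau>: "\<tau> \<in> {0<..<e}"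
      then have "w \<tau> \<le> S" using S[of \<tau>] by (auto simp: w_def)
      moreover have "0 < k \<tau>" using \<tau> e pq t0 by (intro positive) auto
      ultimately show "k \<tau> * w \<tau> \<le> k \<tau> * S" by simp
    qed
    then show ?thesis by (simp add: kernel_primitive_def)
  qed
  ultimately have 1: "conv k v t0 - conv k v (t0 - e) \<le>
      v t0 * (kernel_primitive k t0 - kernel_primitive k (t0 - e)) + kernel_primitive k e * S
      + m * ((kernel_primitive k q - kernel_primitive k (q - e)) - (kernel_primitive k p - kernel_primitive k (p - e)))"
    using int by (simp add: algebra_simps)
  have "v t0 * (kernel_primitive k t0 - kernel_primitive k (t0 - e)) \<le> v t0 * (e * k t0)"
    using kernel_primitive_increment_lower[of "t0 - e" t0] e pq t0 neg by (intro mult_left_mono_neg) auto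
  moreover have "m * ((kernel_primitive k q - kernel_primitive k (q - e)) - (kernel_primitive k p - kernel_primitive k (p - e)))
      \<le> m * (e * k (q - e) - e * k p)"
    using kernel_primitive_increment_upper[of "q - e" q] kernel_primitive_increment_lower[of "p - e" p] e pq t0 m(1)
    by (intro mult_left_mono) auto
  ultimately show ?thesis using 1 by (simp add: algebra_simps)
qed

text \<open>
  The minimum rule for \<open>Dk\<close>. Only the difference quotient from the left enters, because it sees no
  values of \<open>v\<close> after \<open>t0\<close>; it is also the one that exists at the final time \<open>T\<close>.
\<close>

lemma Dk_le_at_min:
  assumes t0: "0 < t0" "t0 \<le> T" and v: "continuous_on {0..T} v"
    and diff: "conv k v differentiable (at t0 within {0..T})"
    and lim: "((\<lambda>\<epsilon>. 1 / \<epsilon> * (LBINT \<tau>:{0<..<\<epsilon>}. k \<tau>) * (SUP s\<in>{0..\<epsilon>}. \<bar>v (t0 - s) - v t0\<bar>)) \<longlongrightarrow> 0) (at_right 0)"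
    and pq: "0 < p" "p \<le> q" "q \<le> t0"
    and neg: "v t0 \<le> 0" and min: "\<And>s. s \<in> {0..t0} \<Longrightarrow> v t0 \<le> v s"
    and m: "0 \<le> m" "\<And>\<tau>. \<tau> \<in> {p..q} \<Longrightarrow> v t0 + m \<le> v (t0 - \<tau>)"
  shows "Dk T k v t0 \<le> v t0 * k t0 - m * (k p - k q)"
proof -
  define R where "R \<epsilon> = 1 / \<epsilon> * (LBINT \<tau>:{0<..<\<epsilon>}. k \<tau>) * (SUP s\<in>{0..\<epsilon>}. \<bar>v (t0 - s) - v t0\<bar>)" for \<epsilon>
  have "(conv k v has_vector_derivative Dk T k v t0) (at t0 within {0..T})"
    using diff unfolding Dk_def vector_derivative_works[symmetric] .
  then have "((\<lambda>t. (conv k v t - conv k v t0) / (t - t0)) \<longlongrightarrow> Dk T k v t0) (at t0 within {0..T})"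
    by (simp add: has_real_derivative_iff_has_vector_derivative[symmetric] has_field_derivative_iff)
  moreover have "filterlim (\<lambda>e. t0 - e) (at t0 within {0..T}) (at_right 0)"
    unfolding filterlim_at
  proof
    show "\<forall>\<^sub>F e in at_right 0. t0 - e \<in> {0..T} \<and> t0 - e \<noteq> t0"
      using eventually_at_right_real[OF t0(1)] by eventually_elim (use t0(2) in auto)
    have "((\<lambda>e. t0 - e) \<longlongrightarrow> t0 - 0) (at_right 0)" by (intro tendsto_intros)
    then show "((\<lambda>e. t0 - e) \<longlongrightarrow> t0) (at_right 0)" by simp
  qed
  ultimately have "((\<lambda>e. (conv k v (t0 - e) - conv k v t0) / (t0 - e - t0)) \<longlongrightarrow> Dk T k v t0) (at_right 0)"
    by (rule filterlim_compose)
  moreover have "(\<lambda>e. (conv k v (t0 - e) - conv k v t0) / (t0 - e - t0)) =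
      (\<lambda>e. (conv k v t0 - conv k v (t0 - e)) / e)"
    by (simp add: fun_eq_iff diff_divide_distrib)
  ultimately have D: "((\<lambda>e. (conv k v t0 - conv k v (t0 - e)) / e) \<longlongrightarrow> Dk T k v t0) (at_right 0)"
    by simp
  have kq: "((\<lambda>e. k (q - e)) \<longlongrightarrow> k q) (at_right 0)"
  proof (rule continuous_on_tendsto_compose[OF continuous])
    have "((\<lambda>e. q - e) \<longlongrightarrow> q - 0) (at_right 0)" by (intro tendsto_intros)
    then show "((\<lambda>e. q - e) \<longlongrightarrow> q) (at_right 0)" by simp
    show "\<forall>\<^sub>F e in at_right 0. q - e \<in> {0<..T}"
      using eventually_at_right_real[of 0 q] pq t0(2) by (auto elim!: eventually_mono)
  qed (use pq t0 in auto)
  have R_lim: "((\<lambda>e. v t0 * k t0 + R e + m * (k (q - e) - k p)) \<longlongrightarrow> v t0 * k t0 + 0 + m * (k q - k p)) (at_right 0)"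
    by (intro tendsto_intros kq lim[folded R_def])
  have "Dk T k v t0 \<le> v t0 * k t0 + 0 + m * (k q - k p)"
  proof (rule tendsto_le[OF _ R_lim D])
    show "\<forall>\<^sub>F e in at_right 0. (conv k v t0 - conv k v (t0 - e)) / e \<le> v t0 * k t0 + R e + m * (k (q - e) - k p)"
      using eventually_at_right_real[OF pq(1)]
    proof eventually_elim
      case (elim e)
      define S where "S = (SUP s\<in>{0..e}. \<bar>v (t0 - s) - v t0\<bar>)"
      have "continuous_on {0..e} (\<lambda>s. \<bar>v (t0 - s) - v t0\<bar>)"
        by (intro continuous_intros continuous_on_compose2[OF v]) (use elim pq t0 in auto)
      then have "bdd_above ((\<lambda>s. \<bar>v (t0 - s) - v t0\<bar>) ` {0..e})"
        by (intro bounded_imp_bdd_above compact_imp_bounded compact_continuous_image) auto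
      then have S: "\<bar>v (t0 - s) - v t0\<bar> \<le> S" if "s \<in> {0..e}" for s
        unfolding S_def by (rule cSUP_upper[OF that])
      have "conv k v t0 - conv k v (t0 - e) \<le>
          e * (v t0 * k t0) + kernel_primitive k e * S + e * (m * (k (q - e) - k p))"
        using elim by (intro conv_increment_le[OF t0(2) v _ _ pq(2,3) neg min m S]) auto
      also have "\<dots> = e * (v t0 * k t0 + R e + m * (k (q - e) - k p))"
        using elim by (simp add: R_def S_def kernel_primitive_def algebra_simps)
      finally show ?case using elim by (simp add: divide_le_eq mult.commute)
    qed
  qed simp
  then show ?thesis by (simp add: algebra_simps)
qed

text \<open>
  A jump \<open>c = u 0 x0 - u0 x0\<close> at a boundary point would add \<open>c\<close> times the primitive of \<open>k\<close> to the convolution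
  at \<open>x0\<close>, but not at nearby points of \<open>X\<close>. The growth of the convolution between two positive times is
  controlled by \<open>Dk\<close>, which is continuous in \<open>x\<close>, so it cannot jump at \<open>x0\<close>; since the primitive of \<open>k\<close> is
  strictly increasing, \<open>c = 0\<close>.
\<close>

lemma initial_value_extends:
  fixes u :: "real \<Rightarrow> 'a::metric_space \<Rightarrow> real" and u0 :: "'a \<Rightarrow> real"
  assumes X: "compact (closure X)"
    and u: "continuous_on ({0..T} \<times> closure X) (\<lambda>(t, x). u t x)"
    and diff: "\<And>t x. t \<in> {0<..T} \<Longrightarrow> x \<in> closure X \<Longrightarrow>
      conv k (\<lambda>s. u s x - u0 x) differentiable (at t within {0..T})"
    and contD: "continuous_on ({0<..T} \<times> closure X) (\<lambda>(t, x). Dk T k (\<lambda>s. u s x - u0 x) t)"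
    and init: "\<And>x. x \<in> X \<Longrightarrow> u 0 x = u0 x"
    and x0: "x0 \<in> closure X"
  shows "u 0 x0 = u0 x0"
proof -
  define G where "G t x = Dk T k (\<lambda>s. u s x - u0 x) t" for t x
  define C where "C t x = conv k (\<lambda>s. u s x - u0 x) t" for t x
  define V where "V x s = u s x - u 0 x" for x s
  define c where "c = u 0 x0 - u0 x0"
  \<comment> \<open>Away from time 0 the function \<open>G\<close> is uniformly continuous; any time in \<open>{0<..<T}\<close> would serve.\<close>
  define h where "h = T / 2"
  have h: "0 < h" "h < T" using T_pos by (auto simp: h_def)
  let ?K = "kernel_primitive k"
  have cu: "continuous_on {0..T} (\<lambda>s. u s x)" if "x \<in> closure X" for x
  proof -
    have "continuous_on {0..T} (\<lambda>s. case (s, x) of (t, x) \<Rightarrow> u t x)"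
      by (rule continuous_on_compose2[OF u]) (use that in \<open>auto intro!: continuous_intros\<close>)
    then show ?thesis by simp
  qed
  then have cV: "continuous_on {0..t} (V x)" if "x \<in> closure X" "t \<le> T" for x t
    unfolding V_def by (intro continuous_intros continuous_on_subset[OF cu[OF that(1)]]) (use that in auto)
  have Cx0: "C t x0 = conv k (V x0) t + c * ?K t" if "0 \<le> t" "t \<le> T" for t
  proof -
    have "conv k (\<lambda>s. V x0 s - (- c)) t = conv k (V x0) t - conv k (\<lambda>_. - c) t"
      using cV[OF x0 that(2)] by (intro conv_diff that) auto
    then show ?thesis by (simp add: C_def V_def c_def conv_const left_diff_distrib)
  qed
  have bound: "\<bar>c\<bar> * (?K T - ?K h) \<le> e * (T - h + 2 * ?K T + 2 * ?K h)" if e: "e > 0" for e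
  proof -
    have uc1: "uniformly_continuous_on ({0..T} \<times> closure X) (\<lambda>(t, x). u t x)"
      by (intro compact_uniformly_continuous u compact_Times X) auto
    obtain d1 where d1: "d1 > 0" "\<And>z z'. z \<in> {0..T} \<times> closure X \<Longrightarrow> z' \<in> {0..T} \<times> closure X \<Longrightarrow> dist z' z < d1 \<Longrightarrow>
        dist (case z' of (t, x) \<Rightarrow> u t x) (case z of (t, x) \<Rightarrow> u t x) < e"
      using uniformly_continuous_onE[OF uc1 e] by metis
    have "continuous_on ({h..T} \<times> closure X) (\<lambda>(t, x). G t x)"
      unfolding G_def by (rule continuous_on_subset[OF contD]) (use h in auto)
    then have uc2: "uniformly_continuous_on ({h..T} \<times> closure X) (\<lambda>(t, x). G t x)"
      by (intro compact_uniformly_continuous compact_Times X) auto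
    obtain d2 where d2: "d2 > 0" "\<And>z z'. z \<in> {h..T} \<times> closure X \<Longrightarrow> z' \<in> {h..T} \<times> closure X \<Longrightarrow> dist z' z < d2 \<Longrightarrow>
        dist (case z' of (t, x) \<Rightarrow> G t x) (case z of (t, x) \<Rightarrow> G t x) < e"
      using uniformly_continuous_onE[OF uc2 e] by metis
    obtain x where x: "x \<in> X" "dist x x0 < min d1 d2"
      using x0 d1(1) d2(1) unfolding closure_approachable by (metis min_less_iff_conj)
    then have xc: "x \<in> closure X" using closure_subset by blast
    have ux: "\<bar>u s x - u s x0\<bar> < e" if "s \<in> {0..T}" for s
      using d1(2)[of "(s, x0)" "(s, x)"] that x xc x0 by (simp add: dist_Pair_Pair dist_real_def)
    have Gx: "\<bar>G s x - G s x0\<bar> < e" if "s \<in> {h..T}" for s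
      using d2(2)[of "(s, x0)" "(s, x)"] that x xc x0 by (simp add: dist_Pair_Pair dist_real_def)
    have Cx: "\<bar>conv k (V x0) t - C t x\<bar> \<le> 2 * e * ?K t" if t: "0 \<le> t" "t \<le> T" for t
    proof -
      have "C t x = conv k (V x) t"
        using init[OF x(1)] by (simp add: C_def V_def[abs_def])
      moreover have "conv k (\<lambda>s. V x0 s - V x s) t = conv k (V x0) t - conv k (V x) t"
        by (intro conv_diff cV t x0 xc)
      moreover have "\<bar>conv k (\<lambda>s. V x0 s - V x s) t\<bar> \<le> (2 * e) * ?K t"
      proof (rule abs_conv_le[OF t])
        show "continuous_on {0..t} (\<lambda>s. V x0 s - V x s)"
          by (intro continuous_intros cV t x0 xc)
        fix s assume "s \<in> {0..t}"
        then show "\<bar>V x0 s - V x s\<bar> \<le> 2 * e"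
          using ux[of s] ux[of 0] t T_pos by (simp add: V_def)
      qed
      ultimately show ?thesis by simp
    qed
    have "norm ((C T x0 - C T x) - (C h x0 - C h x)) \<le> e * norm (T - h)"
    proof (rule field_differentiable_bound[where S = "{h..T}" and f' = "\<lambda>t. G t x0 - G t x"])
      fix t assume t: "t \<in> {h..T}"
      have der: "((\<lambda>t. C t y) has_field_derivative G t y) (at t within {h..T})" if "y \<in> closure X" for y
      proof -
        have "(conv k (\<lambda>s. u s y - u0 y) has_vector_derivative G t y) (at t within {0..T})"
          using diff[of t y] that t h unfolding G_def Dk_def vector_derivative_works[symmetric] by simp
        then have "(conv k (\<lambda>s. u s y - u0 y) has_field_derivative G t y) (at t within {0..T})"
          by (simp add: has_real_derivative_iff_has_vector_derivative)
        then show ?thesis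
          unfolding C_def by (rule DERIV_subset) (use h in auto)
      qed
      show "((\<lambda>t. C t x0 - C t x) has_field_derivative G t x0 - G t x) (at t within {h..T})"
        by (intro DERIV_diff der x0 xc)
      show "norm (G t x0 - G t x) \<le> e" using Gx[OF t] by simp
    qed (use h in auto)
    then have "\<bar>(C T x0 - C T x) - (C h x0 - C h x)\<bar> \<le> e * (T - h)" using h by simp
    moreover have "(C T x0 - C T x) - (C h x0 - C h x) =
        (conv k (V x0) T - C T x) - (conv k (V x0) h - C h x) + c * (?K T - ?K h)"
      using Cx0[of T] Cx0[of h] h by (simp add: algebra_simps)
    ultimately have "\<bar>c * (?K T - ?K h)\<bar> \<le> e * (T - h) + 2 * e * ?K T + 2 * e * ?K h"
      using Cx[of T] Cx[of h] h by linarith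
    moreover have "?K h \<le> ?K T"
    proof -
      have "0 \<le> (T - h) * k T"
        using positive[of T] h T_pos by (intro mult_nonneg_nonneg) auto
      also have "\<dots> \<le> ?K T - ?K h"
        using h by (intro kernel_primitive_increment_lower) auto
      finally show ?thesis by simp
    qed
    ultimately show ?thesis by (simp add: abs_mult algebra_simps)
  qed
  have "0 < (T - h) * k T" using h positive[of T] T_pos by simp
  then have K: "0 < ?K T - ?K h"
    using kernel_primitive_increment_lower[of h T] h by simp
  define L where "L = T - h + 2 * ?K T + 2 * ?K h"
  have L: "L > 0"
    using kernel_primitive_nonneg[of T] kernel_primitive_nonneg[of h] h by (simp add: L_def)
  have "\<bar>c\<bar> * (?K T - ?K h) \<le> 0 + e" if "e > 0" for e
    using bound[of "e / L"] that L by (simp add: L_def[symmetric])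
  then have "\<bar>c\<bar> * (?K T - ?K h) \<le> 0" by (rule field_le_epsilon)
  then have "\<bar>c\<bar> \<le> 0" using K by (simp add: mult_le_0_iff)
  then show ?thesis by (simp add: c_def)
qed

end

section \<open>Nonnegativity and propagation of zeros\<close>

text \<open>
  The differential equation enters only through \<open>super\<close>, an inequality for \<open>Dk\<close> at negative spatial minima,
  so the space is an arbitrary compact metric space.
\<close>

lemma (in decreasing_kernel) nonneg_if_supersolution_at_minima:
  fixes u :: "real \<Rightarrow> 'a::metric_space \<Rightarrow> real"
  assumes blowup: "filterlim k at_top (at_right 0)"
    and Y: "compact Y" and u: "continuous_on ({0..T} \<times> Y) (\<lambda>(t, x). u t x)"
    and init: "\<And>x. x \<in> Y \<Longrightarrow> 0 \<le> u 0 x"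
    and diff: "\<And>t x. t \<in> {0<..T} \<Longrightarrow> x \<in> Y \<Longrightarrow>
      conv k (\<lambda>s. u s x - u 0 x) differentiable (at t within {0..T})"
    and lim: "\<And>t x. t \<in> {0<..T} \<Longrightarrow> x \<in> Y \<Longrightarrow>
      ((\<lambda>\<epsilon>. 1 / \<epsilon> * (LBINT \<tau>:{0<..<\<epsilon>}. k \<tau>) * (SUP s\<in>{0..\<epsilon>}. \<bar>u (t - s) x - u t x\<bar>)) \<longlongrightarrow> 0) (at_right 0)"
    and \<eta>: "0 < \<eta>"
    and super: "\<And>t x. t \<in> {0<..T} \<Longrightarrow> x \<in> Y \<Longrightarrow> - \<eta> < u t x \<Longrightarrow> u t x < 0 \<Longrightarrow>
      (\<And>y. y \<in> Y \<Longrightarrow> u t x \<le> u t y) \<Longrightarrow> M * u t x \<le> Dk T k (\<lambda>s. u s x - u 0 x) t"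
    and tx: "t \<in> {0..T}" "x \<in> Y"
  shows "0 \<le> u t x"
proof -
  have "uniformly_continuous_on ({0..T} \<times> Y) (\<lambda>(t, x). u t x)"
    by (intro compact_uniformly_continuous u compact_Times Y) auto
  from uniformly_continuous_onE[OF this \<eta>]
  obtain d1 where d1: "d1 > 0" "\<And>z z'. z \<in> {0..T} \<times> Y \<Longrightarrow> z' \<in> {0..T} \<times> Y \<Longrightarrow> dist z' z < d1 \<Longrightarrow>
      dist (case z' of (t, x) \<Rightarrow> u t x) (case z of (t, x) \<Rightarrow> u t x) < \<eta>"
    by metis
  have "\<forall>\<^sub>F r in at_right 0. M < k r" using blowup by (simp add: filterlim_at_top_dense)
  then obtain d2 where d2: "d2 > 0" "\<And>r. 0 < r \<Longrightarrow> r < d2 \<Longrightarrow> M < k r"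
    unfolding eventually_at_right_field by blast
  define \<delta> where "\<delta> = min d1 d2 / 2"
  have \<delta>: "0 < \<delta>" "\<delta> < d1" "\<delta> < d2" using d1(1) d2(1) by (auto simp: \<delta>_def min_def)
  have step: "0 \<le> u r y"
    if s: "0 \<le> s" and IH: "\<And>r y. r \<in> {0..min s T} \<Longrightarrow> y \<in> Y \<Longrightarrow> 0 \<le> u r y"
      and r: "r \<in> {0..min (s + \<delta>) T}" and y: "y \<in> Y" for s r y
  proof (rule ccontr)
    assume neg: "\<not> 0 \<le> u r y"
    define Z where "Z = {0..min (s + \<delta>) T} \<times> Y"
    have "compact Z" unfolding Z_def by (intro compact_Times Y) simp
    moreover have "continuous_on Z (\<lambda>(t, x). u t x)"
      by (rule continuous_on_subset[OF u]) (auto simp: Z_def)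
    moreover have "Z \<noteq> {}" using r y by (auto simp: Z_def)
    ultimately obtain z where z: "z \<in> Z" "\<And>z'. z' \<in> Z \<Longrightarrow> (case z of (t, x) \<Rightarrow> u t x) \<le> (case z' of (t, x) \<Rightarrow> u t x)"
      using continuous_attains_inf by metis
    obtain t1 x1 where z1: "z = (t1, x1)" by (cases z)
    have t1: "0 \<le> t1" "t1 \<le> s + \<delta>" "t1 \<le> T" and x1: "x1 \<in> Y" using z(1) by (auto simp: z1 Z_def)
    have min1: "u t1 x1 \<le> u t' x'" if "t' \<in> {0..min (s + \<delta>) T}" "x' \<in> Y" for t' x'
      using z(2)[of "(t', x')"] that by (simp add: z1 Z_def)
    have neg1: "u t1 x1 < 0" using min1[OF r y] neg by simp
    have st1: "s < t1"
    proof (rule ccontr)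
      assume "\<not> s < t1"
      then have "0 \<le> u t1 x1" using t1 by (intro IH x1) auto
      then show False using neg1 by simp
    qed
    have "dist (u t1 x1) (u s x1) < \<eta>"
      using d1(2)[of "(s, x1)" "(t1, x1)"] s st1 t1 x1 \<delta> by (simp add: dist_Pair_Pair dist_real_def)
    moreover have "0 \<le> u s x1" using s st1 t1 by (intro IH x1) auto
    ultimately have small: "- \<eta> < u t1 x1" by (simp add: dist_real_def)
    have M: "M < k (t1 - s)" using d2(2)[of "t1 - s"] st1 t1 \<delta> by simp
    define v where "v r = u r x1 - u 0 x1" for r
    have cv: "continuous_on {0..T} v"
    proof -
      have "continuous_on {0..T} (\<lambda>r. case (r, x1) of (t, x) \<Rightarrow> u t x)"
        by (rule continuous_on_compose2[OF u]) (use x1 in \<open>auto intro!: continuous_intros\<close>)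
      then show ?thesis unfolding v_def by (intro continuous_intros) simp
    qed
    have u0: "0 \<le> u 0 x1" by (rule init[OF x1])
    \<comment> \<open>Lags in \<open>{t1 - s..t1}\<close> reach back to \<open>{0..s}\<close>, where \<open>u \<ge> 0\<close> exceeds the minimum by \<open>- u t1 x1\<close>.\<close>
    have "Dk T k v t1 \<le> v t1 * k t1 - (- u t1 x1) * (k (t1 - s) - k t1)"
    proof (rule Dk_le_at_min)
      show "conv k v differentiable (at t1 within {0..T})"
        using diff[of t1 x1] st1 s t1 x1 unfolding v_def by simp
      show "((\<lambda>\<epsilon>. 1 / \<epsilon> * (LBINT \<tau>:{0<..<\<epsilon>}. k \<tau>) * (SUP s\<in>{0..\<epsilon>}. \<bar>v (t1 - s) - v t1\<bar>)) \<longlongrightarrow> 0) (at_right 0)"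
        using lim[of t1 x1] st1 s t1 x1 unfolding v_def by simp
      show "v t1 \<le> v s'" if "s' \<in> {0..t1}" for s'
        using min1[of s' x1] that t1 x1 by (simp add: v_def)
      show "v t1 + - u t1 x1 \<le> v (t1 - \<tau>)" if "\<tau> \<in> {t1 - s..t1}" for \<tau>
        using IH[of "t1 - \<tau>" x1] that t1 st1 x1 by (simp add: v_def)
    qed (use st1 s t1 cv neg1 u0 in \<open>auto simp: v_def\<close>)
    also have "\<dots> = u t1 x1 * k (t1 - s) - u 0 x1 * k t1"
      by (simp add: v_def algebra_simps)
    also have "\<dots> \<le> u t1 x1 * k (t1 - s)"
      using u0 positive[of t1] st1 s t1 by simp
    also have "\<dots> < u t1 x1 * M"
      using M neg1 by (rule mult_strict_left_mono_neg)
    also have "\<dots> \<le> Dk T k v t1"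
      using super[of t1 x1] st1 s t1 x1 small neg1 min1[of t1] unfolding v_def by (simp add: mult.commute)
    finally show False by simp
  qed
  have grid: "0 \<le> u r y" if "r \<in> {0..min (real n * \<delta>) T}" "y \<in> Y" for n r y
    using that
  proof (induction n arbitrary: r y)
    case 0
    then show ?case using init T_pos by simp
  next
    case (Suc n)
    show ?case
      by (rule step[of "real n * \<delta>"]) (use Suc \<delta>(1) in \<open>auto simp: algebra_simps\<close>)
  qed
  obtain n where "T < real n * \<delta>" using reals_Archimedean3[OF \<delta>(1)] by blast
  then show ?thesis using tx by (intro grid[of t n]) auto
qed

text \<open>
  The time \<open>t1\<close> is the first zero after a time \<open>t\<close> with \<open>v t > 0\<close>. For every lag \<open>p\<close> up to \<open>t1 - t\<close> the
  minimum rule on the window \<open>{p..t1 - t}\<close> gives \<open>k p \<le> k (t1 - t)\<close>, which bounds \<open>k\<close> near 0.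
\<close>

lemma (in decreasing_kernel) zero_propagates_backwards:
  assumes blowup: "filterlim k at_top (at_right 0)"
    and v: "continuous_on {0..T} v" and nonneg: "\<And>t. t \<in> {0..T} \<Longrightarrow> 0 \<le> v t"
    and diff: "\<And>t. t \<in> {0<..T} \<Longrightarrow> conv k (\<lambda>s. v s - v 0) differentiable (at t within {0..T})"
    and lim: "\<And>t. t \<in> {0<..T} \<Longrightarrow>
      ((\<lambda>\<epsilon>. 1 / \<epsilon> * (LBINT \<tau>:{0<..<\<epsilon>}. k \<tau>) * (SUP s\<in>{0..\<epsilon>}. \<bar>v (t - s) - v t\<bar>)) \<longlongrightarrow> 0) (at_right 0)"
    and super: "\<And>t. t \<in> {0<..T} \<Longrightarrow> v t = 0 \<Longrightarrow> 0 \<le> Dk T k (\<lambda>s. v s - v 0) t"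
    and t0: "t0 \<in> {0..T}" "v t0 = 0" and t: "t \<in> {0..t0}"
  shows "v t = 0"
proof (rule ccontr)
  assume nz: "v t \<noteq> 0"
  define Z where "Z = {s \<in> {t..t0}. v s = 0}"
  have cont: "continuous_on {t..t0} v" by (rule continuous_on_subset[OF v]) (use t t0 in auto)
  have "closed Z" unfolding Z_def by (rule continuous_closed_preimage_constant[OF cont]) simp
  then have "compact ({t..t0} \<inter> Z)" by (intro compact_Int_closed) auto
  moreover have "{t..t0} \<inter> Z = Z" by (auto simp: Z_def)
  ultimately have "compact Z" by simp
  moreover have "Z \<noteq> {}" using t0 t by (auto simp: Z_def)
  ultimately obtain t1 where "t1 \<in> Z" and first: "\<And>s. s \<in> Z \<Longrightarrow> t1 \<le> s"
    using compact_attains_inf by metis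
  then have t1: "t \<le> t1" "t1 \<le> t0" "v t1 = 0" by (auto simp: Z_def)
  with nz have lt: "t < t1" by (cases "t = t1") auto
  have pos: "0 < v s" if "s \<in> {t..<t1}" for s
    using first[of s] nonneg[of s] that t t0 t1 by (force simp: Z_def)
  have const: "k p \<le> k (t1 - t)" if p: "0 < p" "p \<le> t1 - t" for p
  proof -
    have "continuous_on {t..t1 - p} v" by (rule continuous_on_subset[OF v]) (use p t t0 t1 in auto)
    moreover have "{t..t1 - p} \<noteq> {}" using p by simp
    ultimately obtain s0 where s0: "s0 \<in> {t..t1 - p}" "\<And>s. s \<in> {t..t1 - p} \<Longrightarrow> v s0 \<le> v s"
      using continuous_attains_inf[of "{t..t1 - p}" v] by auto
    define m where "m = v s0"
    have m: "0 < m" using pos[of s0] s0(1) p by (simp add: m_def)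
    have v0: "0 \<le> v 0" using nonneg[of 0] T_pos by simp
    have "0 \<le> Dk T k (\<lambda>s. v s - v 0) t1" using super[of t1] t1 lt t t0 by simp
    also have "\<dots> \<le> (v t1 - v 0) * k t1 - m * (k p - k (t1 - t))"
    proof (rule Dk_le_at_min)
      show "continuous_on {0..T} (\<lambda>s. v s - v 0)" by (intro continuous_intros v)
      show "conv k (\<lambda>s. v s - v 0) differentiable (at t1 within {0..T})"
        using diff[of t1] lt t t1 t0 by simp
      show "((\<lambda>\<epsilon>. 1 / \<epsilon> * (LBINT \<tau>:{0<..<\<epsilon>}. k \<tau>) *
          (SUP s\<in>{0..\<epsilon>}. \<bar>v (t1 - s) - v 0 - (v t1 - v 0)\<bar>)) \<longlongrightarrow> 0) (at_right 0)"
        using lim[of t1] lt t t1 t0 by simp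
      show "v t1 - v 0 \<le> v s - v 0" if "s \<in> {0..t1}" for s
        using nonneg[of s] that t1 t0 by simp
      show "v t1 - v 0 + m \<le> v (t1 - \<tau>) - v 0" if "\<tau> \<in> {p..t1 - t}" for \<tau>
        using s0(2)[of "t1 - \<tau>"] that t1 by (simp add: m_def)
    qed (use lt t t0 t1 p m v0 in auto)
    also have "\<dots> = - (v 0 * k t1) - m * (k p - k (t1 - t))" using t1 by simp
    also have "\<dots> \<le> - (m * (k p - k (t1 - t)))"
      using v0 positive[of t1] lt t t0 t1 by simp
    finally show ?thesis using m by (simp add: mult_le_0_iff)
  qed
  have "\<forall>\<^sub>F p in at_right 0. k (t1 - t) < k p"
    using blowup by (simp add: filterlim_at_top_dense)
  moreover have "\<forall>\<^sub>F p in at_right 0. p \<in> {0<..<t1 - t}"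
    using eventually_at_right_real[of 0 "t1 - t"] lt by simp
  ultimately have "\<forall>\<^sub>F p in at_right (0::real). False"
    by eventually_elim (use const in force)
  then show False by simp
qed

section \<open>The positivity principle\<close>

theorem theorem2:
  fixes \<Omega> :: "(real^'n) set" and T :: real
    and k :: "real \<Rightarrow> real"
    and a :: "real^'n \<Rightarrow> real^'n^'n" and b :: "real^'n \<Rightarrow> real^'n"
    and B :: "(real^'n) boundary_operator"
    and f :: "real \<Rightarrow> real \<Rightarrow> real^'n \<Rightarrow> real"
    and u :: "real \<Rightarrow> real^'n \<Rightarrow> real"
    and Du :: "real \<Rightarrow> real^'n \<Rightarrow> real^'n" and D2u :: "real \<Rightarrow> real^'n \<Rightarrow> real^'n^'n"
    and u0 :: "real^'n \<Rightarrow> real" and g :: "real \<Rightarrow> real^'n \<Rightarrow> real"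
  assumes "open \<Omega>" and "connected \<Omega>" and "bounded \<Omega>" and "C1_boundary \<Omega>"
    and "T > 0"
    and "set_integrable lborel {0<..<T} k"
    and "continuous_on {0<..T} k"
    and "\<forall>t\<in>{0<..T}. k t > 0"
    and "antimono_on {0<..T} k"
    and "filterlim k at_top (at_right 0)"
    and "continuous_on (closure \<Omega>) a" and "continuous_on (closure \<Omega>) b"
    and "uniformly_elliptic \<Omega> a"
    and "admissible_boundary_operator \<Omega> B"
    and "continuous_on (UNIV \<times> {0..T} \<times> closure \<Omega>) (\<lambda>(w, t, x). f w t x)"
    and "\<exists>M\<ge>0. \<exists>\<eta>>0. \<forall>w\<in>{-\<eta><..<0}. \<forall>t\<in>{0..T}. \<forall>x\<in>closure \<Omega>. f w t x \<ge> - M * \<bar>w\<bar>"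
    and "continuous_on ({0..T} \<times> closure \<Omega>) (\<lambda>(t, x). u t x)"
    and "C2_space_closure {0<..T} \<Omega> u Du D2u"
    and "\<forall>t\<in>{0<..T}. \<forall>x\<in>closure \<Omega>.
           conv k (\<lambda>s. u s x - u0 x) differentiable (at t within {0..T})"
    and "continuous_on ({0<..T} \<times> closure \<Omega>) (\<lambda>(t, x). Dk T k (\<lambda>s. u s x - u0 x) t)"
    and "\<forall>t\<in>{0<..<T}. \<forall>x\<in>\<Omega>.
           Dk T k (\<lambda>s. u s x - u0 x) t = elliptic_op a b x (Du t x) (D2u t x) + f (u t x) t x"
    and "\<forall>x\<in>\<Omega>. u 0 x = u0 x"
    and "\<forall>t\<in>{0<..<T}. \<forall>x\<in>frontier \<Omega>. boundary_op B x (u t x) (Du t x) = g t x"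
    and "\<forall>t\<in>{0<..T}. \<forall>x\<in>closure \<Omega>.
           ((\<lambda>\<epsilon>. 1 / \<epsilon> * (LBINT \<tau>:{0<..<\<epsilon>}. k \<tau>) * (SUP s\<in>{0..\<epsilon>}. \<bar>u (t - s) x - u t x\<bar>))
              \<longlongrightarrow> 0) (at_right 0)"
    and "\<forall>x\<in>\<Omega>. u0 x \<ge> 0"
    and "\<forall>t\<in>{0<..<T}. \<forall>x\<in>frontier \<Omega>. g t x \<ge> 0"
  shows "(\<forall>t\<in>{0..T}. \<forall>x\<in>closure \<Omega>. u t x \<ge> 0) \<and>
    (\<forall>t0\<in>{0<..T}. \<forall>x0\<in>Omega_N B \<Omega>. u t0 x0 = 0 \<longrightarrow> (\<forall>t\<in>{0..t0}. u t x0 = 0))"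
proof -
  note \<Omega> = \<open>open \<Omega>\<close> and elliptic = \<open>uniformly_elliptic \<Omega> a\<close>
  interpret decreasing_kernel T k
    by unfold_locales (use \<open>T > 0\<close> \<open>set_integrable lborel {0<..<T} k\<close> \<open>continuous_on {0<..T} k\<close>
      \<open>\<forall>t\<in>{0<..T}. k t > 0\<close> \<open>antimono_on {0<..T} k\<close> in auto)
  note blowup = \<open>filterlim k at_top (at_right 0)\<close>
  have cptY: "compact (closure \<Omega>)" using \<open>bounded \<Omega>\<close> by (simp add: compact_closure)
  note cu = \<open>continuous_on ({0..T} \<times> closure \<Omega>) (\<lambda>(t, x). u t x)\<close>
  note diff = \<open>\<forall>t\<in>{0<..T}. \<forall>x\<in>closure \<Omega>.
           conv k (\<lambda>s. u s x - u0 x) differentiable (at t within {0..T})\<close>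
  note cD = \<open>continuous_on ({0<..T} \<times> closure \<Omega>) (\<lambda>(t, x). Dk T k (\<lambda>s. u s x - u0 x) t)\<close>
  note lim = \<open>\<forall>t\<in>{0<..T}. \<forall>x\<in>closure \<Omega>.
           ((\<lambda>\<epsilon>. 1 / \<epsilon> * (LBINT \<tau>:{0<..<\<epsilon>}. k \<tau>) * (SUP s\<in>{0..\<epsilon>}. \<bar>u (t - s) x - u t x\<bar>))
              \<longlongrightarrow> 0) (at_right 0)\<close>
  note cf = \<open>continuous_on (UNIV \<times> {0..T} \<times> closure \<Omega>) (\<lambda>(w, t, x). f w t x)\<close>
  note C2 = \<open>C2_space_closure {0<..T} \<Omega> u Du D2u\<close>
  note pde_inner = \<open>\<forall>t\<in>{0<..<T}. \<forall>x\<in>\<Omega>.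
           Dk T k (\<lambda>s. u s x - u0 x) t = elliptic_op a b x (Du t x) (D2u t x) + f (u t x) t x\<close>
  note bc = \<open>\<forall>t\<in>{0<..<T}. \<forall>x\<in>frontier \<Omega>. boundary_op B x (u t x) (Du t x) = g t x\<close>
    and g = \<open>\<forall>t\<in>{0<..<T}. \<forall>x\<in>frontier \<Omega>. g t x \<ge> 0\<close>
  note admissible = \<open>admissible_boundary_operator \<Omega> B\<close>
  have pd: "has_partial_derivative (u t) j (Du t x $ j) x"
    and pd2: "has_partial_derivative (\<lambda>y. Du t y $ j) i (D2u t x $ i $ j) x"
    if "t \<in> {0<..T}" "x \<in> \<Omega>" for t x i j
    using C2 that by (auto simp: C2_space_closure_def)
  have cDu: "continuous_on ({0<..T} \<times> closure \<Omega>) (\<lambda>z. Du (fst z) (snd z))"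
    and cD2u: "continuous_on ({0<..T} \<times> closure \<Omega>) (\<lambda>z. D2u (fst z) (snd z))"
    using C2 by (auto simp: C2_space_closure_def case_prod_beta')
  have cu': "continuous_on ({0..T} \<times> closure \<Omega>) (\<lambda>z. u (fst z) (snd z))"
    using cu by (simp add: case_prod_beta')
  have slices: "continuous_on (closure \<Omega>) (u t)" "continuous_on (closure \<Omega>) (Du t)"
    "continuous_on (closure \<Omega>) (D2u t)" if "t \<in> {0<..T}" for t
  proof -
    have "continuous_on (closure \<Omega>) (\<lambda>x. u (fst (t, x)) (snd (t, x)))"
      by (rule continuous_on_compose2[OF cu']) (use that in \<open>auto intro!: continuous_intros\<close>)
    then show "continuous_on (closure \<Omega>) (u t)" by simp
    have "continuous_on (closure \<Omega>) (\<lambda>x. Du (fst (t, x)) (snd (t, x)))"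
      by (rule continuous_on_compose2[OF cDu]) (use that in \<open>auto intro!: continuous_intros\<close>)
    then show "continuous_on (closure \<Omega>) (Du t)" by simp
    have "continuous_on (closure \<Omega>) (\<lambda>x. D2u (fst (t, x)) (snd (t, x)))"
      by (rule continuous_on_compose2[OF cD2u]) (use that in \<open>auto intro!: continuous_intros\<close>)
    then show "continuous_on (closure \<Omega>) (D2u t)" by simp
  qed
  have orbit: "continuous_on {0..T} (\<lambda>t. u t x)" if "x \<in> closure \<Omega>" for x
  proof -
    have "continuous_on {0..T} (\<lambda>t. u (fst (t, x)) (snd (t, x)))"
      by (rule continuous_on_compose2[OF cu']) (use that in \<open>auto intro!: continuous_intros\<close>)
    then show ?thesis by simp
  qed
  have orbitD: "continuous_on {0<..T} (\<lambda>t. Du t x)" if "x \<in> closure \<Omega>" for x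
  proof -
    have "continuous_on {0<..T} (\<lambda>t. Du (fst (t, x)) (snd (t, x)))"
      by (rule continuous_on_compose2[OF cDu]) (use that in \<open>auto intro!: continuous_intros\<close>)
    then show ?thesis by simp
  qed
  have u0: "u 0 x = u0 x" if "x \<in> closure \<Omega>" for x
    by (rule initial_value_extends[OF cptY cu _ cD _ that])
       (use diff \<open>\<forall>x\<in>\<Omega>. u 0 x = u0 x\<close> in auto)
  have init: "0 \<le> u 0 x" if "x \<in> closure \<Omega>" for x
  proof -
    have "continuous_on (closure \<Omega>) (\<lambda>x. u (fst (0::real, x)) (snd (0::real, x)))"
      by (rule continuous_on_compose2[OF cu']) (use T_pos in \<open>auto intro!: continuous_intros\<close>)
    then have c: "continuous_on (closure \<Omega>) (u 0)" by simp
    have "u 0 x \<in> {0..}"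
      by (rule continuous_on_closed_property[where S = "closure \<Omega>" and A = \<Omega>, OF c])
         (use that closure_subset \<open>\<forall>x\<in>\<Omega>. u0 x \<ge> 0\<close> \<open>\<forall>x\<in>\<Omega>. u 0 x = u0 x\<close> in auto)
    then show ?thesis by simp
  qed
  have pde: "Dk T k (\<lambda>s. u s x - u 0 x) t = elliptic_op a b x (Du t x) (D2u t x) + f (u t x) t x"
    if t: "t \<in> {0<..T}" and x: "x \<in> closure \<Omega>" for t x
  proof -
    define F where "F z = Dk T k (\<lambda>s. u s (snd z) - u0 (snd z)) (fst z)
      - (elliptic_op a b (snd z) (Du (fst z) (snd z)) (D2u (fst z) (snd z)) + f (u (fst z) (snd z)) (fst z) (snd z))"
      for z
    let ?S = "{0<..T} \<times> closure \<Omega>"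
    have "continuous_on ?S (\<lambda>z. Dk T k (\<lambda>s. u s (snd z) - u0 (snd z)) (fst z))"
      using cD by (simp add: case_prod_beta')
    moreover have "continuous_on ?S (\<lambda>z. a (snd z))" "continuous_on ?S (\<lambda>z. b (snd z))"
      by (rule continuous_on_compose2[OF \<open>continuous_on (closure \<Omega>) a\<close>]
            continuous_on_compose2[OF \<open>continuous_on (closure \<Omega>) b\<close>];
          auto intro!: continuous_intros)+
    then have "continuous_on ?S (\<lambda>z. elliptic_op a b (snd z) (Du (fst z) (snd z)) (D2u (fst z) (snd z)))"
      unfolding elliptic_op_def by (intro continuous_intros cDu cD2u)
    moreover have "continuous_on ?S (\<lambda>z. f (u (fst z) (snd z)) (fst z) (snd z))"
    proof -
      have "continuous_on ?S (\<lambda>z. u (fst z) (snd z))"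
        by (rule continuous_on_subset[OF cu']) auto
      then have "continuous_on ?S (\<lambda>z. case (u (fst z) (snd z), fst z, snd z) of (w, t, x) \<Rightarrow> f w t x)"
        by (intro continuous_on_compose2[OF cf] continuous_on_Pair continuous_intros) auto
      then show ?thesis by (simp add: case_prod_beta')
    qed
    ultimately have cF: "continuous_on ?S F"
      unfolding F_def by (intro continuous_intros)
    have "F (t, x) \<in> {0}"
    proof (rule continuous_on_closed_property[OF cF, where A = "{0<..<T} \<times> \<Omega>"])
      show "{0<..<T} \<times> \<Omega> \<subseteq> ?S" using closure_subset by auto
      show "?S \<subseteq> closure ({0<..<T} \<times> \<Omega>)"
        using T_pos by (auto simp: closure_Times closure_greaterThanLessThan)
      show "F z \<in> {0}" if "z \<in> {0<..<T} \<times> \<Omega>" for z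
        using pde_inner that by (auto simp: F_def)
    qed (use t x in auto)
    then show ?thesis using u0[OF x] by (simp add: F_def)
  qed
  have bc_nonneg: "0 \<le> boundary_op B x (u t x) (Du t x)" if t: "t \<in> {0<..T}" and x: "x \<in> frontier \<Omega>" for t x
  proof -
    have xc: "x \<in> closure \<Omega>" using x by (simp add: frontier_def)
    have "continuous_on {0<..T} (\<lambda>t. boundary_op B x (u t x) (Du t x))"
    proof (cases B)
      case Dirichlet
      have "continuous_on {0<..T} (\<lambda>t. u t x)" by (rule continuous_on_subset[OF orbit[OF xc]]) auto
      then show ?thesis by (simp add: Dirichlet)
    next
      case (Oblique \<omega>)
      then show ?thesis using orbitD[OF xc] by (auto intro!: continuous_intros)
    qed
    then have "boundary_op B x (u t x) (Du t x) \<in> {0..}"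
      by (rule continuous_on_closed_property[where A = "{0<..<T}"])
         (use T_pos t x bc g in \<open>auto simp: closure_greaterThanLessThan\<close>)
    then show ?thesis by simp
  qed
  \<comment> \<open>The inequality at spatial minima that feeds both conclusions.\<close>
  have at_min: "f (u t x) t x \<le> Dk T k (\<lambda>s. u s x - u 0 x) t"
    if t: "t \<in> {0<..T}" and x: "x \<in> closure \<Omega>" and min: "\<And>y. y \<in> closure \<Omega> \<Longrightarrow> u t x \<le> u t y"
      and place: "x \<in> \<Omega> \<or> (\<exists>\<omega>. B = Oblique \<omega>)" for t x
  proof -
    have spot: "x \<in> \<Omega> \<or> (\<exists>\<nu> \<omega>. x \<in> frontier \<Omega> \<and> is_outer_normal \<Omega> x \<nu> \<and> 0 < \<omega> \<bullet> \<nu> \<and> 0 \<le> \<omega> \<bullet> Du t x)"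
    proof (cases "x \<in> \<Omega>")
      case False
      with place obtain \<omega> where B: "B = Oblique \<omega>" by blast
      have fr: "x \<in> frontier \<Omega>" using False x \<Omega> by (simp add: frontier_def interior_open)
      have "is_outer_normal \<Omega> x (outer_normal \<Omega> x)"
        by (rule is_outer_normal_outer_normal[OF \<open>C1_boundary \<Omega>\<close> fr \<Omega>])
      moreover have "0 < \<omega> x \<bullet> outer_normal \<Omega> x" using admissible fr by (simp add: B)
      moreover have "0 \<le> \<omega> x \<bullet> Du t x" using bc_nonneg[OF t fr] by (simp add: B)
      ultimately show ?thesis using fr by blast
    qed simp
    have "0 \<le> elliptic_op a b x (Du t x) (D2u t x)"
      by (rule elliptic_op_nonneg_at_min[OF \<Omega> _ _ slices[OF t]
            \<open>continuous_on (closure \<Omega>) a\<close> elliptic x _ spot]) (use pd[OF t] pd2[OF t] min in auto)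
    then show ?thesis using pde[OF t x] by simp
  qed
  obtain M \<eta> where M: "M \<ge> 0" and \<eta>: "\<eta> > 0"
    and f_lower: "\<And>w t x. w \<in> {-\<eta><..<0} \<Longrightarrow> t \<in> {0..T} \<Longrightarrow> x \<in> closure \<Omega> \<Longrightarrow> f w t x \<ge> - M * \<bar>w\<bar>"
    using \<open>\<exists>M\<ge>0. \<exists>\<eta>>0. \<forall>w\<in>{-\<eta><..<0}. \<forall>t\<in>{0..T}. \<forall>x\<in>closure \<Omega>. f w t x \<ge> - M * \<bar>w\<bar>\<close> by metis
  have diff0: "conv k (\<lambda>s. u s x - u 0 x) differentiable (at t within {0..T})"
    if "t \<in> {0<..T}" "x \<in> closure \<Omega>" for t x
    using diff that u0[OF that(2)] by simp
  have nonneg: "0 \<le> u t x" if "t \<in> {0..T}" "x \<in> closure \<Omega>" for t x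
  proof (rule nonneg_if_supersolution_at_minima[OF blowup cptY cu init diff0 _ \<eta> _ that])
    fix t x
    assume t: "t \<in> {0<..T}" and x: "x \<in> closure \<Omega>" and w: "- \<eta> < u t x" "u t x < 0"
      and min: "\<And>y. y \<in> closure \<Omega> \<Longrightarrow> u t x \<le> u t y"
    have place: "x \<in> \<Omega> \<or> (\<exists>\<omega>. B = Oblique \<omega>)"
    proof (cases B)
      case Dirichlet
      have "x \<notin> frontier \<Omega>" using bc_nonneg[OF t, of x] w by (auto simp: Dirichlet)
      then show ?thesis using x \<Omega> by (simp add: frontier_def interior_open)
    qed simp
    have "f (u t x) t x \<le> Dk T k (\<lambda>s. u s x - u 0 x) t"
      by (rule at_min[OF t x _ place]) (use min in auto)
    moreover have "M * u t x \<le> f (u t x) t x" using f_lower[of "u t x" t x] t x w by simp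
    ultimately show "M * u t x \<le> Dk T k (\<lambda>s. u s x - u 0 x) t" by simp
  qed (use lim in auto)
  \<comment> \<open>The lower bound for \<open>f\<close> is assumed for negative values only; at the value 0 it is a limit.\<close>
  have f0: "0 \<le> f 0 t x" if t: "t \<in> {0..T}" and x: "x \<in> closure \<Omega>" for t x
  proof -
    have "continuous_on {-\<eta><..0} (\<lambda>w. case (w, t, x) of (w, t, x) \<Rightarrow> f w t x)"
      by (intro continuous_on_compose2[OF cf] continuous_on_Pair continuous_intros) (use t x in auto)
    then have "continuous_on {-\<eta><..0} (\<lambda>w. f w t x + M * \<bar>w\<bar>)" by (auto intro!: continuous_intros)
    then have "f 0 t x + M * \<bar>0\<bar> \<in> {0..}"
    proof (rule continuous_on_closed_property[where A = "{-\<eta><..<0}"])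
      show "f w t x + M * \<bar>w\<bar> \<in> {0..}" if "w \<in> {-\<eta><..<0}" for w
        using f_lower[OF that t x] by simp
    qed (use \<eta> in \<open>auto simp: closure_greaterThanLessThan\<close>)
    then show ?thesis by simp
  qed
  have "u t x0 = 0" if t0: "t0 \<in> {0<..T}" and x0: "x0 \<in> Omega_N B \<Omega>" and z: "u t0 x0 = 0" and t: "t \<in> {0..t0}"
    for t0 x0 t
  proof -
    have x0c: "x0 \<in> closure \<Omega>" and place: "x0 \<in> \<Omega> \<or> (\<exists>\<omega>. B = Oblique \<omega>)"
      using x0 closure_subset by (cases B; auto)+
    show ?thesis
    proof (rule zero_propagates_backwards[OF blowup orbit[OF x0c]])
      fix s assume s: "s \<in> {0<..T}" "u s x0 = 0"
      have "f (u s x0) s x0 \<le> Dk T k (\<lambda>r. u r x0 - u 0 x0) s"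
        by (rule at_min[OF s(1) x0c _ place]) (use nonneg s in auto)
      then show "0 \<le> Dk T k (\<lambda>r. u r x0 - u 0 x0) s" using f0[OF _ x0c, of s] s by simp
    qed (use nonneg x0c diff0 lim t0 z t in auto)
  qed
  then show ?thesis using nonneg by blast
qed

end
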